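(* Let $p\ge 7$ be an integer and let $y\mid\beta\sim\mathcal{N}_p(\beta,I_p)$ with unknown $\beta\in\mathbb{R}^p$. The estimator $$\hat{\beta}(y)=\left(1-\frac{\int_0^1\kappa^{p/2+1/2}(1-\kappa)^{-1/2}\exp(-\kappa\|y\|^2/2)\,d\kappa}{\int_0^1\kappa^{p/2-1/2}(1-\kappa)^{-1/2}\exp(-\kappa\|y\|^2/2)\,d\kappa}\right)y,$$ which is the Bayes estimator (posterior mean of $\beta$) under the half-Cauchy prior $\pi(\kappa)\propto\kappa^{-1/2}(1-\kappa)^{-1/2}$ on $\kappa\in(0,1)$, is minimax for estimating $\beta$ under the quadratic loss $\|\hat\beta-\beta\|^2$.
   Context: The hierarchical model is $y\mid\beta\sim\mathcal{N}_p(\beta,I_p)$, $\beta\mid\kappa\sim\mathcal{N}_p\bigl(0,\frac{1-\kappa}{\kappa}I_p\bigr)$, $\kappa\sim\pi(\kappa)$ with $\kappa\in(0,1)$. The norm $\|\cdot\|$ is Euclidean. The risk of an estimator $\delta:\mathbb{R}^p\to\mathbb{R}^p$ at $\beta$ is $R(\beta,\delta)=E_\beta[\|\delta(Y)-\beta\|^2]$, where $Y\sim\mathcal{N}_p(\beta,I_p)$. An estimator $\delta$ is minimax if $\sup_{\beta\in\mathbb{R}^p}R(\beta,\delta)=\inf_{\delta'}\sup_{\beta\in\mathbb{R}^p}R(\beta,\delta')$, the infimum being over all estimators. It is well known that the usual estimator $\delta(y)=y$ is minimax, with constant risk $p$; hence $\delta$ is minimax if and only if $R(\beta,\delta)\le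 p$ for all $\beta\in\mathbb{R}^p$. *)

theory Defs
  imports "HOL-Probability.Probability"
begin

(* Lebesgue density of N_p(mu, v I_p), for v > 0; the components are independent and
   normal_density takes the standard deviation, not the variance. *)
definition mvn_density :: "real ^ 'p \<Rightarrow> real \<Rightarrow> real ^ 'p \<Rightarrow> real" where
  "mvn_density \<mu> v x = (\<Prod>i\<in>UNIV. normal_density (\<mu> $ i) (sqrt v) (x $ i))"

definition mvn :: "real ^ 'p \<Rightarrow> real \<Rightarrow> (real ^ 'p) measure" where
  "mvn \<mu> v = density lborel (\<lambda>x. ennreal (mvn_density \<mu> v x))"

(* Taken in ennreal, so that infinite risk is represented as infinity. *)
definition risk :: "real ^ 'p \<Rightarrow> (real ^ 'p \<Rightarrow> real ^ 'p) \<Rightarrow> ennreal" where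
  "risk \<beta> \<delta> = (\<integral>\<^sup>+ y. ennreal ((norm (\<delta> y - \<beta>))\<^sup>2) \<partial>mvn \<beta> 1)"

definition estimators :: "(real ^ 'p \<Rightarrow> real ^ 'p) set" where
  "estimators = borel_measurable borel"

definition minimax :: "(real ^ 'p \<Rightarrow> real ^ 'p) \<Rightarrow> bool" where
  "minimax \<delta> \<longleftrightarrow> \<delta> \<in> estimators \<and>
     (SUP \<beta>. risk \<beta> \<delta>) = (INF \<delta>'\<in>(estimators :: (real ^ 'p \<Rightarrow> real ^ 'p) set). SUP \<beta>. risk \<beta> \<delta>')"

(* The law of kappa = 1 / (1 + lambda^2) for half-Cauchy lambda; Beta (1/2) (1/2)
   is the normalizing constant. *)
definition half_cauchy_kappa :: "real measure" where
  "half_cauchy_kappa = density lborel (\<lambda>\<kappa>. ennreal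
     (indicator {0<..<1} \<kappa> * (\<kappa> powr (-1/2) * (1 - \<kappa>) powr (-1/2) / Beta (1/2) (1/2))))"

(* Marginal law of beta in the hierarchy: kappa is integrated out of N_p(0, (1-kappa)/kappa I_p).
   The kernel only matters for kappa in (0,1), where the variance is positive. *)
definition mixture_prior :: "real measure \<Rightarrow> (real ^ 'p) measure" where
  "mixture_prior K = K \<bind> (\<lambda>\<kappa>. mvn 0 ((1 - \<kappa>) / \<kappa>))"

(* Bayes' rule for the observation y | beta ~ N_p(beta, I_p). *)
definition posterior :: "(real ^ 'p) measure \<Rightarrow> real ^ 'p \<Rightarrow> (real ^ 'p) measure" where
  "posterior P y = density P (\<lambda>\<beta>. ennreal (mvn_density \<beta> 1 y) /
     (\<integral>\<^sup>+ \<beta>'. ennreal (mvn_density \<beta>' 1 y) \<partial>P))"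

definition posterior_mean :: "(real ^ 'p) measure \<Rightarrow> real ^ 'p \<Rightarrow> real ^ 'p" where
  "posterior_mean P y = (\<integral> \<beta>. \<beta> \<partial>posterior P y)"

definition beta_hat :: "real ^ 'p \<Rightarrow> real ^ 'p" where
  "beta_hat y =
     (1 - (LBINT \<kappa>=0..1. \<kappa> powr (real CARD('p) / 2 + 1/2) * (1 - \<kappa>) powr (-1/2)
              * exp (- \<kappa> * (norm y)\<^sup>2 / 2))
        / (LBINT \<kappa>=0..1. \<kappa> powr (real CARD('p) / 2 - 1/2) * (1 - \<kappa>) powr (-1/2)
              * exp (- \<kappa> * (norm y)\<^sup>2 / 2))) *\<^sub>R y"

end

theory Submission
  imports Defs
begin

text \<open>With \<open>r = p/2\<close>, \<open>a = r + 1/2\<close> and \<open>z = (norm y)\<^sup>2 / 2\<close>, conjugacy of the Gaussian components gives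
  posterior mean \<open>(1 - \<mu> z) *\<^sub>R y\<close>, where \<open>\<mu> z\<close> is the expectation of \<open>\<kappa>\<close> under the density proportional
  to \<open>\<kappa> powr r * exp (- \<kappa> * z)\<close> with respect to the half-Cauchy law of \<open>\<kappa>\<close>.

  Lower bound: the Bayes risk under the prior \<open>N(0, v I)\<close> is \<open>p v / (1 + v)\<close>, which tends to \<open>p\<close>.

  Upper bound: by Stein's identity the risk is at most \<open>p\<close> as soon as
  \<open>z * (\<mu> z)\<^sup>2 \<le> p * \<mu> z + 2 * z * \<mu>' z\<close> for all \<open>z \<ge> 0\<close>. Integration by parts in \<open>\<kappa>\<close> gives a Riccati
  equation for \<open>\<mu>\<close>, which removes \<open>\<mu>'\<close> and leaves
  \<open>z * \<mu> z * (2 - \<mu> z) + 2 * \<mu> z \<le> 2 * a\<close>, an upper bound on \<open>\<mu> z\<close>. In terms of \<open>q = a / \<mu>\<close> the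
  Riccati equation is \<open>q' = q - a - q * (q - (a + 1/2)) / z\<close>, and the bound reads
  \<open>2 * q\<^sup>2 - 2 * q * (z + 1) + a * z \<ge> 0\<close>. It follows by comparing \<open>q\<close> with an explicit quadratic
  subsolution for \<open>z \<le> 2 * a + 9/4\<close>, and beyond that point with the larger root of the bound itself, which
  is a subsolution there. Both comparisons use \<open>a \<ge> 4\<close>, that is \<open>p \<ge> 7\<close>.\<close>

section \<open>Polynomial inequalities for the Riccati barriers\<close>

text \<open>The coefficients were found numerically. A single quadratic that works for all \<open>a \<ge> 4\<close> leaves little
  room: at \<open>a = 4\<close> the slack in the differential inequality is below \<open>0.02\<close>.\<close>

definition quad_barrier :: "real \<Rightarrow> real \<Rightarrow> real" where
  "quad_barrier a z = a + 1/2 + z * (z - a + 17/10) / (4 * (a + 1/2))"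

text \<open>The larger root in \<open>q\<close> of the quadratic \<open>risk_poly a z q\<close>,
  when its discriminant is nonnegative.\<close>

definition sqrt_barrier :: "real \<Rightarrow> real \<Rightarrow> real" where
  "sqrt_barrier a z = (z + 1 + sqrt ((z + 1)\<^sup>2 - 2 * a * z)) / 2"

text \<open>Right-hand side of the Riccati equation solved by
  \<open>q = a * laplace r z / laplace (r + 1) z\<close> with \<open>a = r + 1/2\<close>.\<close>

definition riccati :: "real \<Rightarrow> real \<Rightarrow> real \<Rightarrow> real" where
  "riccati a z q = q - a - q * (q - (a + 1/2)) / z"

text \<open>At \<open>q = a / m\<close> with \<open>m = mean_kappa r z\<close> this is
  \<open>a / m^2\<close> times the slack in \<open>mean_kappa_bound\<close>.\<close>

definition risk_poly :: "real \<Rightarrow> real \<Rightarrow> real \<Rightarrow> real" where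
  "risk_poly a z q = 2 * q\<^sup>2 - 2 * q * (z + 1) + a * z"

text \<open>The polynomial increases in \<open>A\<close>, so it suffices to treat the least \<open>A\<close> allowed for a given \<open>t\<close>.\<close>

lemma quad_barrier_poly:
  fixes A t :: real
  assumes A: "9/2 \<le> A" and t: "- A \<le> t" "t \<le> A + 5/4"
  shows "0 \<le> 4*A^2 + A * (3*t^2 - 18/5*t - 341/25) - t^3 - 22/5*t^2 - 121/25*t" (is "0 \<le> ?P A")
proof -
  define B where "B = max (9/2) (max (-t) (t - 5/4))"
  have B: "9/2 \<le> B" "B \<le> A" using A t by (auto simp: B_def)
  \<comment> \<open>The factor to be bounded is the divided difference of \<open>?P\<close> between
    \<open>B\<close> and \<open>A\<close>. Completing the square bounds its \<open>t\<close> terms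
    below, and \<open>4 * (A + B) \<ge> 36\<close> outweighs the remaining constant.\<close>
  have "0 \<le> 3 * (t - 3/5)^2" by simp
  hence "4 * (A + B) + (3*t^2 - 18/5*t - 341/25) \<ge> 0"
    using A B by (simp add: power2_eq_square field_simps)
  hence "0 \<le> (A - B) * (4 * (A + B) + (3*t^2 - 18/5*t - 341/25))"
    using B by simp
  also have "\<dots> = ?P A - ?P B" by (simp add: field_simps power2_eq_square)
  finally have "?P B \<le> ?P A" by simp
  moreover have "0 \<le> ?P B"
  proof -
    consider "B = 9/2" "t \<le> 23/4" | "B = -t" "t \<le> -9/2" | "B = t - 5/4" "23/4 \<le> t"
      unfolding B_def by linarith
    thus ?thesis
    proof cases
      case 1
      \<comment> \<open>At \<open>A = 9/2\<close> the cubic in \<open>t\<close> is the sum of these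
        two nonnegative terms and a positive constant.\<close>
      have "0 \<le> (23/4 - t) * (t - 3/2)^2" using 1 by simp
      moreover have "0 \<le> 7/20 * (t - 11/5)^2" by simp
      ultimately show ?thesis
        unfolding 1(1) by (simp add: power2_eq_square power3_eq_cube field_simps)
    next
      case 2
      \<comment> \<open>In the distance \<open>r\<close> from the endpoint of the case all
        coefficients are nonnegative; the third case works the same way.\<close>
      define r where "r = - t - 9/2"
      have t: "t = - r - 9/2" and r: "0 \<le> r" using 2 by (auto simp: r_def)
      have "0 \<le> r * r" "0 \<le> r * r * r" using r by simp_all
      thus ?thesis using r
        unfolding 2(1) t by (simp add: power2_eq_square power3_eq_cube field_simps)
    next
      case 3
      define r where "r = t - 23/4"
      have t: "t = r + 23/4" and r: "0 \<le> r" using 3 by (auto simp: r_def)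
      have "0 \<le> r * r" "0 \<le> r * r * r" using r by simp_all
      thus ?thesis using r
        unfolding 3(1) t by (simp add: power2_eq_square power3_eq_cube field_simps)
    qed
  qed
  ultimately show ?thesis by linarith
qed

text \<open>Centring at \<open>A = a + 1/2\<close> writes the barrier as \<open>A + z * w\<close>
  with \<open>w\<close> linear in \<open>t = z - A\<close>, so the division by \<open>z\<close> in
  the Riccati term cancels. The slack times \<open>16 * A^2\<close> is the polynomial of
  \<open>quad_barrier_poly\<close>, and the range of \<open>z\<close> gives the range of
  \<open>t\<close> there.\<close>

lemma quad_barrier_subsolution:
  assumes a: "4 \<le> a" and z: "0 < z" "z \<le> 2 * a + 9/4"
  shows "(2 * z - a + 17/10) / (4 * (a + 1/2)) \<le> riccati a z (quad_barrier a z)"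
proof -
  define A where "A = a + 1/2"
  define t where "t = z - A"
  have a_eq: "a = A - 1/2" and z_eq: "z = A + t" and A: "A \<ge> 9/2"
    using a by (auto simp: A_def t_def)
  have P: "0 \<le> 4*A^2 + A * (3*t^2 - 18/5*t - 341/25) - t^3 - 22/5*t^2 - 121/25*t"
    using z by (intro quad_barrier_poly) (auto simp: A t_def A_def a)
  define w where "w = (t + 11/5) / (4 * A)"
  have w: "4 * A * w = t + 11/5" using A by (simp add: w_def)
  have q: "quad_barrier a z = A + z * w" by (simp add: quad_barrier_def w_def A_def t_def field_simps)
  have "(A + z * w) * (A + z * w - (a + 1/2)) / z = (A + z * w) * w"
    using z by (simp add: A_def)
  moreover have "(2 * z - a + 17/10) / (4 * (a + 1/2)) = w + z / (4 * A)"
  proof -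
    have "2 * z - a + 17/10 = (t + 11/5) + z" by (simp add: t_def A_def)
    thus ?thesis unfolding w_def A_def[symmetric] by (simp only: add_divide_distrib)
  qed
  ultimately have "riccati a z (quad_barrier a z) - (2 * z - a + 17/10) / (4 * (a + 1/2))
     = 1/2 + z * w - (A + z * w) * w - (w + z / (4 * A))"
    unfolding q riccati_def by (simp add: a_eq)
  also have "16 * A^2 * \<dots> = 8*A^2 + 4*A*z*(4*A*w) - (4*A^2 + z * (4*A*w)) * (4*A*w) - 4*A*(4*A*w) - 4*A*z"
    using A by (simp add: field_simps power2_eq_square)
  also have "\<dots> = 4*A^2 + A * (3*t^2 - 18/5*t - 341/25) - t^3 - 22/5*t^2 - 121/25*t"
    unfolding w z_eq by (simp add: algebra_simps power2_eq_square power3_eq_cube)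
  finally have "0 \<le> 16 * A^2 * (riccati a z (quad_barrier a z) - (2 * z - a + 17/10) / (4 * (a + 1/2)))"
    using P by simp
  thus ?thesis using A by (simp add: zero_le_mult_iff)
qed

text \<open>The vertex of \<open>risk_poly a z\<close> in \<open>q\<close> is
  \<open>(z + 1) / 2\<close>, so this puts the barrier on the increasing branch, as
  \<open>risk_poly_mono\<close> requires. Completing the square in \<open>z\<close> proves
  it.\<close>

lemma quad_barrier_ge:
  assumes a: "4 \<le> a"
  shows "z + 1 \<le> 2 * quad_barrier a z"
proof -
  define A where "A = a + 1/2"
  have a_eq: "a = A - 1/2" and A: "A \<ge> 9/2" using a by (auto simp: A_def)
  have "0 \<le> (z - (3*A - 11/5)/2)^2 + (A - 9/2) * (7/4 * A + 11/8) + 11/20" using A by simp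
  also have "\<dots> \<le> 4*A^2 - 2*A + z^2 - 3*A*z + 11/5*z"
    using A by (simp add: power2_eq_square field_simps)
  also have "\<dots> = 2 * A * (2 * quad_barrier a z - (z + 1))"
    using A unfolding quad_barrier_def a_eq by (simp add: field_simps power2_eq_square)
  finally show ?thesis using A by (simp add: zero_le_mult_iff)
qed

lemma quad_barrier_pos:
  assumes "4 \<le> a" "0 \<le> z" shows "0 < quad_barrier a z"
  using quad_barrier_ge[of a z] assms by linarith

text \<open>\<open>W\<close> is a quarter of the discriminant in \<open>q\<close>. Near 0 the
  barrier exceeds \<open>z + 1\<close>, which makes both parts of the polynomial nonnegative; on the
  middle range \<open>W \<le> 0\<close>, so every \<open>q\<close> is admissible; beyond it the
  square of \<open>2 * ?q - (z + 1)\<close> is compared with \<open>W\<close>.\<close>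

lemma quad_barrier_risk_poly:
  assumes a: "4 \<le> a" and z: "0 \<le> z" "z \<le> 2 * a + 9/4"
  shows "0 \<le> risk_poly a z (quad_barrier a z)"
proof -
  define A where "A = a + 1/2"
  have a_eq: "a = A - 1/2" and A: "A \<ge> 9/2" using a by (auto simp: A_def)
  let ?q = "quad_barrier a z"
  define W where "W = (z + 1)^2 - 2 * a * z"
  have T: "2 * risk_poly a z ?q = (2 * ?q - (z + 1))^2 - W"
    by (simp add: risk_poly_def W_def power2_eq_square algebra_simps)
  consider "z \<le> 1/2" | "1/2 \<le> z" "z \<le> 2*a - 5/2" | "2*a - 5/2 \<le> z" by linarith
  thus ?thesis
  proof cases
    case 1
    have "z * (A - 11/5 - z) \<le> 1/2 * A" using 1 z A by (intro mult_mono) auto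
    hence "-1/8 \<le> z * (z - a + 17/10) / (4 * A)"
      using A unfolding a_eq by (simp add: field_simps)
    hence "z + 1 \<le> ?q" using 1 A unfolding quad_barrier_def A_def by linarith
    hence "0 \<le> 2 * ?q * (?q - (z + 1))" using z by simp
    moreover have "0 \<le> a * z" using a z by simp
    ultimately have "0 \<le> 2 * ?q * (?q - (z + 1)) + a * z" by linarith
    thus ?thesis by (simp add: risk_poly_def power2_eq_square algebra_simps)
  next
    case 2
    have "(z - 1/2) * (z - (2*a - 5/2)) \<le> 0" using 2 by (simp add: mult_nonneg_nonpos)
    moreover have "(z - 1/2) * (z - (2*a - 5/2)) = W + (a - 9/4)"
      by (simp add: W_def power2_eq_square field_simps)
    ultimately have "W \<le> 0" using a by linarith
    thus ?thesis using T zero_le_power2[of "2 * ?q - (z + 1)"] by linarith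
  next
    case 3
    \<comment> \<open>In the offsets \<open>y\<close> and \<open>s\<close> the expansion below has
      negative coefficients only at \<open>s^3\<close> and \<open>s^3 * y\<close>;
      \<open>s \<le> 19/4\<close> lets the \<open>s^2\<close> terms absorb them.\<close>
    define y where "y = A - 9/2"
    define s where "s = 2*a + 9/4 - z"
    define V where "V = 2*A * (2 * ?q - (z + 1))"
    have ys: "0 \<le> y" "0 \<le> s" "s \<le> 19/4" using A z 3 by (auto simp: y_def s_def)
    have Ay: "A = 9/2 + y" and zy: "z = 2*(9/2 + y) + 5/4 - s" by (auto simp: y_def s_def A_def)
    have V: "V = 4*A^2 - 2*A + z^2 - 3*A*z + 11/5*z"
      using A unfolding V_def quad_barrier_def a_eq by (simp add: field_simps power2_eq_square)
    have "0 \<le> s\<^sup>2 * (19/4 - s)" using ys by simp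
    hence s3: "s^3 \<le> 19/4 * s^2" by (simp add: algebra_simps power2_eq_square power3_eq_cube)
    have sy3: "s^3 * y \<le> 19/4 * s^2 * y" using mult_right_mono[OF s3 ys(1)] by simp
    have "0 \<le> 899001/6400 + 287067/800 * y + 91769/400 * y^2 + 263/5 * y^3 + 4 * y^4
      + s * (4773/100 + 32633/200 * y + 499/10 * y^2 + 4 * y^3)
      + 25223/200 * s^2 - 92/5 * s^3 + (257/10 * s^2 * y - 2 * (s^3 * y)) + s^2 * y^2 + s^4"
    proof -
      have "0 \<le> 25223/200 * s^2 - 92/5 * s^3"
        using s3 zero_le_power2[of s] by linarith
      moreover have "0 \<le> 257/10 * s^2 * y - 2 * (s^3 * y)"
        using sy3 mult_nonneg_nonneg[OF zero_le_power2[of s] ys(1)] by linarith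
      moreover have "0 \<le> s * (4773/100 + 32633/200 * y + 499/10 * y^2 + 4 * y^3)"
        using ys by simp
      moreover have "0 \<le> 899001/6400 + 287067/800 * y + 91769/400 * y^2 + 263/5 * y^3 + 4 * y^4"
        using ys by simp
      moreover have "0 \<le> s^2 * y^2" "0 \<le> s^4" by simp_all
      ultimately show ?thesis by linarith
    qed
    also have "\<dots> = V^2 - 4 * A^2 * W"
      unfolding V W_def a_eq Ay zy by (simp add: field_simps power2_eq_square power3_eq_cube power4_eq_xxxx)
    also have "\<dots> = 4 * A^2 * ((2 * ?q - (z + 1))^2 - W)"
      unfolding V_def by (simp add: algebra_simps power2_eq_square)
    finally have "0 \<le> (2 * ?q - (z + 1))^2 - W" using A by (simp add: zero_le_mult_iff)
    thus ?thesis using T by linarith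
  qed
qed

lemma risk_poly_mono:
  assumes "0 \<le> risk_poly a z l" "z + 1 \<le> 2 * l" "l \<le> q"
  shows "0 \<le> risk_poly a z q"
proof -
  have "0 \<le> 2 * (q - l) * (q + l - (z + 1))" using assms by simp
  also have "\<dots> = risk_poly a z q - risk_poly a z l"
    by (simp add: risk_poly_def algebra_simps power2_eq_square)
  finally show ?thesis using assms by simp
qed

section \<open>The larger root of the risk polynomial as a barrier for large
  \<open>z\<close>\<close>

lemma discriminant_pos:
  fixes a z :: real
  assumes a: "4 \<le> a" and z: "2 * a + 9/4 \<le> z"
  shows "0 < (z + 1)\<^sup>2 - 2 * a * z"
proof -
  \<comment> \<open>In these offsets, which are nonnegative on the region, the discriminant has only
    positive coefficients.\<close>
  define x y where "x = z - (2*a + 9/4)" and "y = a - 4"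
  have a_eq: "a = 4 + y" and z_eq: "z = 2 * (4 + y) + 9/4 + x" and p: "0 \<le> x" "0 \<le> y"
    using a z by (auto simp: x_def y_def)
  have "(z + 1)\<^sup>2 - 2 * a * z = x^2 + 2*(x*y) + 29/2*x + 17/2*y + 713/16"
    unfolding a_eq z_eq by (simp add: power2_eq_square field_simps)
  also have "0 < \<dots>" using p by (intro add_nonneg_pos add_nonneg_nonneg) auto
  finally show ?thesis .
qed

lemma sqrt_barrier_risk_poly:
  assumes "4 \<le> a" "2 * a + 9/4 \<le> z"
  shows "risk_poly a z (sqrt_barrier a z) = 0"
proof -
  define s where "s = sqrt ((z + 1)\<^sup>2 - 2 * a * z)"
  have "s^2 = (z + 1)\<^sup>2 - 2 * a * z" using discriminant_pos[OF assms] by (simp add: s_def)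
  thus ?thesis unfolding risk_poly_def sqrt_barrier_def s_def[symmetric]
    by (simp add: power2_eq_square field_simps)
qed

text \<open>With \<open>s\<close> the square root of the discriminant, the slack times
  \<open>2 * z * s\<close> is \<open>L - s * M\<close>. As \<open>L \<ge> 0\<close>, comparing
  squares suffices and removes the root; \<open>L^2 - s^2 * M^2\<close> has only positive
  coefficients in the offsets \<open>x\<close> and \<open>y\<close>.\<close>

lemma sqrt_barrier_subsolution:
  assumes a: "4 \<le> a" and z: "2 * a + 9/4 \<le> z"
  shows "(1 + (z + 1 - a) / sqrt ((z + 1)\<^sup>2 - 2 * a * z)) / 2 \<le> riccati a z (sqrt_barrier a z)"
proof -
  define x y where "x = z - (2*a + 9/4)" and "y = a - 4"
  have a_eq: "a = 4 + y" and z_eq: "z = 2 * (4 + y) + 9/4 + x" and p: "0 \<le> x" "0 \<le> y"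
    using a z by (auto simp: x_def y_def)
  define s where "s = sqrt ((z + 1)\<^sup>2 - 2 * a * z)"
  have s: "0 < s" and s2: "s^2 = (z + 1)\<^sup>2 - 2 * a * z"
    using discriminant_pos[OF a z] by (simp_all add: s_def)
  define L where "L = (a - 3/2) * z^2 - 2 * (a - 1)^2 * z + (a - 1/2)"
  define M where "M = 3/2 * z - a + 1/2"
  have "L = 2613/32 + 793/16*y + 13/2*y^2 + x*(133/4 + 37/2*y + 2*y^2) + x^2 * (5/2 + y)"
    unfolding L_def z_eq a_eq by (simp add: field_simps power2_eq_square)
  hence L: "0 \<le> L" using p by simp
  have "L^2 - s^2 * M^2 = 24559/64 + 1223379/256*y + 751609/256*y^2 + 9765/16*y^3 + 169/4*y^4
      + x * (14383/8 + 152839/32*y + 38219/16*y^2 + 1723/4*y^3 + 26*y^4)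
      + x^2 * (756 + 2833/2*y + 4727/8*y^2 + 87*y^3 + 4*y^4)
      + x^3 * (98 + 297/2*y + 47*y^2 + 4*y^3)
      + x^4 * (4 + 5*y + y^2)"
    unfolding L_def M_def s2 z_eq a_eq
    by (simp add: field_simps power2_eq_square power3_eq_cube power4_eq_xxxx)
  hence "0 \<le> L^2 - s^2 * M^2" using p by simp
  hence "(s * M)^2 \<le> L^2" by (simp add: power_mult_distrib)
  hence sM: "s * M \<le> L" using L power2_le_imp_le by blast
  have z0: "0 < z" using a z by linarith
  have "s * (2 * z) * (riccati a z (sqrt_barrier a z) - (1 + (z + 1 - a) / s) / 2)
      = s * (2 * z * (sqrt_barrier a z - a) - 2 * sqrt_barrier a z * (sqrt_barrier a z - (a + 1/2)))
        - z * (s + (z + 1 - a))"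
    unfolding riccati_def using z0 s by (simp add: field_simps)
  \<comment> \<open>The last summand is zero by \<open>s2\<close>; with it the equality is a
    polynomial identity valid for every \<open>s\<close>.\<close>
  also have "\<dots> = s * (-(3/2) * z + (a - 1/2)) + (a - 1/2) * s^2 - z * (z + 1 - a)
       + s * ((z + 1)^2 - 2 * a * z - s^2) / 2"
    unfolding sqrt_barrier_def s_def[symmetric] by (simp add: field_simps power2_eq_square)
  also have "\<dots> = L - s * M"
    unfolding s2 by (simp add: L_def M_def field_simps power2_eq_square)
  finally have "0 \<le> s * (2 * z) * (riccati a z (sqrt_barrier a z) - (1 + (z + 1 - a) / s) / 2)"
    using sM by simp
  moreover have "0 < s * (2 * z)" using z0 s by simp
  ultimately have "0 \<le> riccati a z (sqrt_barrier a z) - (1 + (z + 1 - a) / s) / 2"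
    by (meson zero_le_mult_iff not_less)
  thus ?thesis by (simp add: s_def)
qed

section \<open>Moments under the half-Cauchy law\<close>

lemma Beta_half_pos: "0 < Beta (1/2) (1/2::real)"
  by (simp add: Beta_def Gamma_real_pos)

lemma nn_integral_half_cauchy_density:
  "(\<integral>\<^sup>+\<kappa>. ennreal (indicator {0<..<1} \<kappa> * (\<kappa> powr (-1/2) * (1 - \<kappa>) powr (-1/2) / Beta (1/2) (1/2))) \<partial>lborel) = 1"
proof -
  have B: "0 < Beta (1/2) (1/2::real)" by (rule Beta_half_pos)
  have "((\<lambda>t. t powr (-1/2) * (1 - t) powr (-1/2)) has_integral Beta (1/2) (1/2::real)) {0..1}"
    using has_integral_Beta_real[of "1/2" "1/2"] by simp
  hence "((\<lambda>t. t powr (-1/2) * (1 - t) powr (-1/2) / Beta (1/2) (1/2))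
      has_integral (Beta (1/2) (1/2) / Beta (1/2) (1/2::real))) {0..1}"
    by (rule has_integral_divide)
  hence *: "((\<lambda>t. t powr (-1/2) * (1 - t) powr (-1/2) / Beta (1/2) (1/2))
      has_integral (1::real)) {0..1}" using B by simp
  have "(\<integral>\<^sup>+x. ennreal (x powr (-1/2) * (1 - x) powr (-1/2) / Beta (1/2) (1/2)) * indicator {0..1::real} x \<partial>lborel) = ennreal 1"
    by (rule nn_integral_has_integral_lebesgue'[OF _ *]) (use B in auto)
  \<comment> \<open>Since \<open>0 powr (-1/2) = 0\<close>, the open and the closed interval give
    the same function, even at the endpoints.\<close>
  moreover have "ennreal (indicator {0<..<1} \<kappa> * (\<kappa> powr (-1/2) * (1 - \<kappa>) powr (-1/2) / Beta (1/2) (1/2)))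
      = ennreal (\<kappa> powr (-1/2) * (1 - \<kappa>) powr (-1/2) / Beta (1/2) (1/2)) * indicator {0..1::real} \<kappa>" for \<kappa>
    by (cases "\<kappa> = 0 \<or> \<kappa> = 1") (auto simp: indicator_def)
  ultimately show ?thesis by simp
qed

lemma sets_half_cauchy_kappa [measurable_cong]: "sets half_cauchy_kappa = sets borel"
  by (simp add: half_cauchy_kappa_def)

lemma space_half_cauchy_kappa [simp]: "space half_cauchy_kappa = UNIV"
  by (simp add: half_cauchy_kappa_def)

lemma half_cauchy_density_nonneg:
  "0 \<le> indicator {0<..<1} \<kappa> * (\<kappa> powr (-1/2) * (1 - \<kappa>) powr (-1/2) / Beta (1/2) (1/2::real))"
  using Beta_half_pos by (auto simp: indicator_def)

interpretation half_cauchy: prob_space half_cauchy_kappa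
proof
  show "emeasure half_cauchy_kappa (space half_cauchy_kappa) = 1"
    unfolding space_half_cauchy_kappa
    using nn_integral_half_cauchy_density by (simp add: half_cauchy_kappa_def emeasure_density)
qed

lemma AE_half_cauchy: "AE \<kappa> in half_cauchy_kappa. 0 < \<kappa> \<and> \<kappa> < 1"
  unfolding half_cauchy_kappa_def
  by (subst AE_density) (auto simp: indicator_def)

text \<open>Up to a constant factor depending on \<open>r\<close> this is Kummer's function
  \<open>1F1(r + 1/2; r + 1; -z)\<close>.\<close>

definition laplace :: "real \<Rightarrow> real \<Rightarrow> real" where
  "laplace r z = (\<integral>\<kappa>. \<kappa> powr r * exp (- (\<kappa> * z)) \<partial>half_cauchy_kappa)"

lemma laplace_integrand_bounds:
  fixes r z \<kappa> :: real
  assumes "0 \<le> r" "0 \<le> z" "0 < \<kappa>" "\<kappa> < 1"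
  shows "0 < \<kappa> powr r * exp (- (\<kappa> * z))" "\<kappa> powr r * exp (- (\<kappa> * z)) \<le> 1"
proof -
  have "\<kappa> powr r \<le> 1" using assms powr_le1[of r \<kappa>] by simp
  moreover have "exp (- (\<kappa> * z)) \<le> 1" using assms by simp
  ultimately show "\<kappa> powr r * exp (- (\<kappa> * z)) \<le> 1" by (simp add: mult_le_one)
qed (use assms in simp)

lemma laplace_integrable:
  assumes "0 \<le> r" "0 \<le> z"
  shows "integrable half_cauchy_kappa (\<lambda>\<kappa>. \<kappa> powr r * exp (- (\<kappa> * z)))"
proof (rule half_cauchy.integrable_const_bound[where B = 1])
  show "AE \<kappa> in half_cauchy_kappa. norm (\<kappa> powr r * exp (- (\<kappa> * z))) \<le> 1"
    using AE_half_cauchy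
  proof eventually_elim
    case (elim \<kappa>)
    thus ?case using laplace_integrand_bounds[OF assms, of \<kappa>] by (simp add: abs_of_pos del: norm_mult abs_mult)
  qed
qed measurable

lemma laplace_pos:
  assumes "0 \<le> r" "0 \<le> z" shows "0 < laplace r z"
proof -
  have "0 \<le> laplace r z" unfolding laplace_def
    by (intro integral_nonneg_AE) auto
  moreover have "laplace r z \<noteq> 0"
  proof
    assume "laplace r z = 0"
    hence "AE \<kappa> in half_cauchy_kappa. \<kappa> powr r * exp (- (\<kappa> * z)) = 0"
      unfolding laplace_def
      by (subst (asm) integral_nonneg_eq_0_iff_AE[OF laplace_integrable[OF assms]]) auto
    hence "AE \<kappa> in half_cauchy_kappa. False"
      using AE_half_cauchy by eventually_elim auto
    thus False by simp
  qed
  ultimately show ?thesis by simp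
qed

lemma laplace_le_one:
  assumes "0 \<le> r" "0 \<le> z" shows "laplace r z \<le> 1"
proof -
  have "laplace r z \<le> (\<integral>\<kappa>. 1 \<partial>half_cauchy_kappa)"
    unfolding laplace_def
  proof (intro integral_mono_AE laplace_integrable assms)
    show "AE \<kappa> in half_cauchy_kappa. \<kappa> powr r * exp (- (\<kappa> * z)) \<le> 1"
      using AE_half_cauchy by eventually_elim (use laplace_integrand_bounds[OF assms] in simp)
  qed simp
  thus ?thesis by (simp add: half_cauchy.prob_space[simplified])
qed

lemma laplace_antimono_exponent:
  assumes "0 \<le> r" "r \<le> s" "0 \<le> z" shows "laplace s z \<le> laplace r z"
  unfolding laplace_def
proof (intro integral_mono_AE laplace_integrable)
  show "AE \<kappa> in half_cauchy_kappa. \<kappa> powr s * exp (- (\<kappa> * z)) \<le> \<kappa> powr r * exp (- (\<kappa> * z))"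
    using AE_half_cauchy
  proof eventually_elim
    case (elim \<kappa>)
    thus ?case using powr_mono'[of r s \<kappa>] assms by (intro mult_right_mono) auto
  qed
qed (use assms in auto)

text \<open>The inequality \<open>1 + u \<le> exp u\<close> under the integral: the graph lies above
  the line through its point at \<open>z\<close> with slope \<open>- laplace (r + 1) z\<close>.
  Differentiability is derived from such lines alone.\<close>

lemma laplace_convex:
  assumes r: "0 \<le> r" and xz: "0 \<le> x" "0 \<le> z"
  shows "laplace r z - (x - z) * laplace (r + 1) z \<le> laplace r x"
proof -
  have "laplace r z - (x - z) * laplace (r + 1) z
     = (\<integral>\<kappa>. \<kappa> powr r * exp (- (\<kappa> * z)) - (x - z) * (\<kappa> powr (r + 1) * exp (- (\<kappa> * z))) \<partial>half_cauchy_kappa)"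
    unfolding laplace_def using assms
    by (subst Bochner_Integration.integral_diff)
      (auto intro!: laplace_integrable integrable_mult_right)
  also have "\<dots> \<le> laplace r x"
    unfolding laplace_def
  proof (intro integral_mono_AE laplace_integrable Bochner_Integration.integrable_diff integrable_mult_right)
    show "AE \<kappa> in half_cauchy_kappa. \<kappa> powr r * exp (- (\<kappa> * z))
        - (x - z) * (\<kappa> powr (r + 1) * exp (- (\<kappa> * z))) \<le> \<kappa> powr r * exp (- (\<kappa> * x))"
      using AE_half_cauchy
    proof eventually_elim
      case (elim \<kappa>)
      have "\<kappa> powr r * exp (- (\<kappa> * z)) - (x - z) * (\<kappa> powr (r + 1) * exp (- (\<kappa> * z)))
          = \<kappa> powr r * exp (- (\<kappa> * z)) * (1 + (- \<kappa> * (x - z)))"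
        using elim by (simp add: powr_add algebra_simps)
      also have "\<dots> \<le> \<kappa> powr r * exp (- (\<kappa> * z)) * exp (- \<kappa> * (x - z))"
        by (intro mult_left_mono exp_ge_add_one_self) simp
      also have "\<dots> = \<kappa> powr r * exp (- (\<kappa> * x))"
        by (simp add: exp_add[symmetric] algebra_simps)
      finally show ?case .
    qed
  qed (use assms in auto)
  finally show ?thesis .
qed

text \<open>The line at \<open>z\<close> makes the remainder \<open>e\<close> nonnegative, the line
  at \<open>y\<close> bounds it by \<open>y - z\<close> times an increment of
  \<open>laplace (r + 1)\<close>. The same lines one order higher show that
  \<open>laplace (r + 1)\<close> is 1-Lipschitz, so \<open>e\<close> is at most
  \<open>\<bar>y - z\<bar> * \<bar>y - z\<bar>\<close>. The one-sided form includes
  \<open>z = 0\<close>.\<close>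

lemma laplace_has_derivative_within:
  assumes r: "0 \<le> r" and z: "0 \<le> z"
  shows "(laplace r has_real_derivative - laplace (r + 1) z) (at z within {0..})"
  unfolding has_field_derivative_iff
proof (rule Lim_transform2)
  show "((\<lambda>_. - laplace (r + 1) z) \<longlongrightarrow> - laplace (r + 1) z) (at z within {0..})"
    by (rule tendsto_const)
  show "((\<lambda>y. - laplace (r + 1) z - (laplace r y - laplace r z) / (y - z)) \<longlongrightarrow> 0) (at z within {0..})"
  proof (rule Lim_null_comparison)
    show "((\<lambda>y. \<bar>y - z\<bar>) \<longlongrightarrow> 0) (at z within {0..})"
      by (auto intro!: tendsto_eq_intros)
    show "\<forall>\<^sub>F y in at z within {0..}.
        norm (- laplace (r + 1) z - (laplace r y - laplace r z) / (y - z)) \<le> \<bar>y - z\<bar>"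
      unfolding eventually_at_filter
    proof (intro always_eventually allI impI)
      fix y assume y: "y \<noteq> z" "y \<in> {0..}"
      define e where "e = laplace r y - laplace r z + (y - z) * laplace (r + 1) z"
      have r2: "0 \<le> laplace (r + 1 + 1) t" "laplace (r + 1 + 1) t \<le> 1" if "0 \<le> t" for t
        using r that laplace_pos[of "r+1+1" t] laplace_le_one[of "r+1+1" t] by auto
      have lo: "0 \<le> e" using laplace_convex[OF r, of y z] y z by (simp add: e_def)
      have hi: "e \<le> (y - z) * (laplace (r + 1) z - laplace (r + 1) y)"
        using laplace_convex[OF r, of z y] y z by (simp add: e_def algebra_simps)
      have 1: "laplace (r + 1) z - laplace (r + 1) y \<le> (y - z) * laplace (r + 1 + 1) z"
        and 2: "laplace (r + 1) y - laplace (r + 1) z \<le> (z - y) * laplace (r + 1 + 1) y"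
        using laplace_convex[of "r+1" y z] laplace_convex[of "r+1" z y] r y z by auto
      have 3: "(y - z) * laplace (r + 1 + 1) z \<le> \<bar>y - z\<bar> * 1"
        and 4: "(z - y) * laplace (r + 1 + 1) y \<le> \<bar>y - z\<bar> * 1"
        using r2 y z by (intro mult_mono; simp)+
      have "\<bar>laplace (r + 1) z - laplace (r + 1) y\<bar> \<le> \<bar>y - z\<bar>"
        using order.trans[OF 1 3] order.trans[OF 2 4] by (intro abs_leI) simp_all
      hence "\<bar>y - z\<bar> * \<bar>laplace (r + 1) z - laplace (r + 1) y\<bar> \<le> \<bar>y - z\<bar> * \<bar>y - z\<bar>"
        by (rule mult_left_mono) simp
      moreover have "e \<le> \<bar>y - z\<bar> * \<bar>laplace (r + 1) z - laplace (r + 1) y\<bar>"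
        using hi abs_ge_self[of "(y - z) * (laplace (r + 1) z - laplace (r + 1) y)"]
        by (simp add: abs_mult)
      ultimately have "\<bar>e\<bar> \<le> \<bar>y - z\<bar> * \<bar>y - z\<bar>" using lo by linarith
      hence "\<bar>e\<bar> / \<bar>y - z\<bar> \<le> \<bar>y - z\<bar>" using y by (simp add: divide_le_eq)
      moreover have "- laplace (r + 1) z - (laplace r y - laplace r z) / (y - z) = - e / (y - z)"
        using y by (simp add: e_def field_simps)
      ultimately show "norm (- laplace (r + 1) z - (laplace r y - laplace r z) / (y - z)) \<le> \<bar>y - z\<bar>"
        by (simp add: abs_divide)
    qed
  qed
qed

lemma laplace_has_derivative:
  assumes "0 \<le> r" "0 < z"
  shows "(laplace r has_real_derivative - laplace (r + 1) z) (at z)"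
proof -
  have "at z within {0..} = at z" using assms by (intro at_within_interior) simp
  thus ?thesis using laplace_has_derivative_within[of r z] assms by simp
qed

lemma continuous_on_laplace: "0 \<le> r \<Longrightarrow> continuous_on {0..} (laplace r)"
  unfolding continuous_on_eq_continuous_within
  using laplace_has_derivative_within DERIV_continuous by fastforce

text \<open>Integrates the derivative of \<open>f\<close>, which vanishes at both endpoints. As
  differentiation raises the exponent, this is Kummer's differential equation for
  \<open>laplace r\<close>.\<close>

lemma laplace_recurrence:
  assumes r: "0 \<le> r" and z: "0 \<le> z"
  shows "z * (laplace (r + 1) z - laplace (r + 2) z) = (r + 1/2) * laplace r z - (r + 1) * laplace (r + 1) z"
proof -
  define b where "b \<kappa> = (r + 1/2) * (\<kappa> powr r * exp (- (\<kappa> * z)))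
      - (r + 1 + z) * (\<kappa> powr (r + 1) * exp (- (\<kappa> * z))) + z * (\<kappa> powr (r + 2) * exp (- (\<kappa> * z)))" for \<kappa> :: real
  define f where "f \<kappa> = \<kappa> powr (r + 1/2) * (1 - \<kappa>) powr (1/2) * exp (- (\<kappa> * z))" for \<kappa> :: real
  define f' where "f' \<kappa> = \<kappa> powr (-1/2) * (1 - \<kappa>) powr (-1/2) * b \<kappa>" for \<kappa> :: real
  define B where "B = Beta (1/2) (1/2::real)"
  have B: "0 < B" unfolding B_def by (rule Beta_half_pos)
  have "(f' has_integral (f 1 - f 0)) {0..1}"
  proof (rule fundamental_theorem_of_calculus_interior)
    show "continuous_on {0..1} f" unfolding f_def using r
      by (intro continuous_intros continuous_on_powr') auto
    fix \<kappa> :: real assume \<kappa>: "\<kappa> \<in> {0<..<1}"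
    have p0: "\<kappa> powr (r + 1/2) = \<kappa> powr (-1/2) * \<kappa> powr (r + 1)"
      unfolding powr_add[symmetric] by (simp add: add.commute)
    have p: "\<kappa> powr (r + 1/2 - 1) = \<kappa> powr (-1/2) * \<kappa> powr r"
      "(1 - \<kappa>) powr (1/2) = (1 - \<kappa>) * (1 - \<kappa>) powr (-1/2)" "(1 - \<kappa>) powr (1/2 - 1) = (1 - \<kappa>) powr (-1/2)"
      "\<kappa> powr (r + 1) = \<kappa> * \<kappa> powr r" "\<kappa> powr (r + 2) = \<kappa> * \<kappa> * \<kappa> powr r"
      using \<kappa> powr_add[of \<kappa> "-1/2" r] powr_add[of "1 - \<kappa>" 1 "-1/2"]
        powr_add[of \<kappa> r 1] powr_add[of \<kappa> r 2]
      by (simp_all add: powr_numeral power2_eq_square)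
    have "(f has_real_derivative ((r + 1/2) * \<kappa> powr (r + 1/2 - 1) * (1 - \<kappa>) powr (1/2) * exp (- (\<kappa> * z))
       + \<kappa> powr (r + 1/2) * (- (1/2) * (1 - \<kappa>) powr (1/2 - 1)) * exp (- (\<kappa> * z))
       + \<kappa> powr (r + 1/2) * (1 - \<kappa>) powr (1/2) * (exp (- (\<kappa> * z)) * (- z)))) (at \<kappa>)"
      unfolding f_def using \<kappa>
      by (auto intro!: derivative_eq_intros has_real_derivative_powr' simp: algebra_simps)
    also have "(r + 1/2) * \<kappa> powr (r + 1/2 - 1) * (1 - \<kappa>) powr (1/2) * exp (- (\<kappa> * z))
       + \<kappa> powr (r + 1/2) * (- (1/2) * (1 - \<kappa>) powr (1/2 - 1)) * exp (- (\<kappa> * z))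
       + \<kappa> powr (r + 1/2) * (1 - \<kappa>) powr (1/2) * (exp (- (\<kappa> * z)) * (- z)) = f' \<kappa>"
      unfolding f'_def b_def p0 p by (simp add: field_simps)
    finally show "(f has_vector_derivative f' \<kappa>) (at \<kappa>)"
      by (simp add: has_real_derivative_iff_has_vector_derivative)
  qed simp
  hence "(f' has_integral 0) {0..1}" using r by (simp add: f_def)
  from has_integral_divide[OF this, of B]
  have I0: "((\<lambda>\<kappa>. f' \<kappa> / B) has_integral 0) {0..1}" by simp
  have b_int: "integrable half_cauchy_kappa b"
    unfolding b_def using r z
    by (intro Bochner_Integration.integrable_add Bochner_Integration.integrable_diff
        laplace_integrable integrable_mult_right) auto
  define g where "g \<kappa> = indicator {0<..<1} \<kappa> * (\<kappa> powr (-1/2) * (1 - \<kappa>) powr (-1/2) / B) * b \<kappa>" for \<kappa> :: real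
  have b_meas [measurable]: "b \<in> borel_measurable borel" unfolding b_def by measurable
  have "integrable lborel g" and gK: "integral\<^sup>L lborel g = (\<integral>\<kappa>. b \<kappa> \<partial>half_cauchy_kappa)"
    using b_int half_cauchy_density_nonneg unfolding g_def half_cauchy_kappa_def B_def
    by (subst (asm) integrable_density, auto simp: integral_density)
  from has_integral_integral_lborel[OF this(1)]
  have "(g has_integral (\<integral>\<kappa>. b \<kappa> \<partial>half_cauchy_kappa)) UNIV" by (simp only: gK)
  \<comment> \<open>The endpoints cause no mismatch, because \<open>0 powr (-1/2) = 0\<close> makes
    \<open>f'\<close> vanish there.\<close>
  moreover have "g = (\<lambda>\<kappa>. if \<kappa> \<in> {0..1} then f' \<kappa> / B else 0)"
  proof
    fix \<kappa> show "g \<kappa> = (if \<kappa> \<in> {0..1} then f' \<kappa> / B else 0)"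
      by (cases "\<kappa> = 0 \<or> \<kappa> = 1") (auto simp: g_def f'_def indicator_def)
  qed
  ultimately have "((\<lambda>\<kappa>. f' \<kappa> / B) has_integral (\<integral>\<kappa>. b \<kappa> \<partial>half_cauchy_kappa)) {0..1}"
    by (simp only: has_integral_restrict_UNIV)
  hence "(\<integral>\<kappa>. b \<kappa> \<partial>half_cauchy_kappa) = 0" using I0 has_integral_unique by blast
  moreover have "(\<integral>\<kappa>. b \<kappa> \<partial>half_cauchy_kappa)
     = (r + 1/2) * laplace r z - (r + 1 + z) * laplace (r + 1) z + z * laplace (r + 2) z"
    unfolding b_def laplace_def using r z
    by (simp add: laplace_integrable integrable_mult_right)
  ultimately show ?thesis by (simp add: algebra_simps)
qed

section \<open>Upper bound for the posterior shrinkage weight\<close>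

text \<open>If \<open>H d < 0\<close>, there is a last point \<open>s\<close> with
  \<open>H s \<ge> 0\<close>. After it \<open>H\<close> is negative, hence strictly increasing,
  which contradicts \<open>H d < 0\<close>.\<close>

lemma nonneg_by_derivative_sign:
  fixes H :: "real \<Rightarrow> real"
  assumes "c \<le> d" "0 \<le> H c" and cont: "continuous_on {c..d} H"
    and der: "\<And>x. \<lbrakk>c < x; x < d; H x < 0\<rbrakk> \<Longrightarrow> \<exists>y. (H has_real_derivative y) (at x) \<and> 0 < y"
  shows "0 \<le> H d"
proof (rule ccontr)
  assume neg: "\<not> 0 \<le> H d"
  define S where "S = {x \<in> {c..d}. 0 \<le> H x}"
  have "closed S" unfolding S_def
    using cont by (intro closed_Collect_le continuous_on_closed_Collect_le continuous_on_const) auto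
  hence "compact S" by (auto simp: S_def compact_eq_bounded_closed intro: bounded_subset[of "{c..d}"])
  moreover have "c \<in> S" using assms by (simp add: S_def)
  ultimately obtain s where s: "s \<in> S" and max: "\<And>t. t \<in> S \<Longrightarrow> t \<le> s"
    using compact_attains_sup[of S] by blast
  have sd: "c \<le> s" "s < d" using s neg by (auto simp: S_def order.order_iff_strict)
  have "H s < H d"
  proof (rule DERIV_pos_imp_increasing_open[OF sd(2)])
    fix x assume "s < x" "x < d"
    thus "\<exists>y. DERIV H x :> y \<and> 0 < y"
      using max[of x] sd by (intro der) (auto simp: S_def not_le[symmetric])
  qed (use cont sd in \<open>auto intro: continuous_on_subset\<close>)
  thus False using s neg by (simp add: S_def)
qed

text \<open>States without division that \<open>q = (r + 1/2) * laplace r / laplace (r + 1)\<close>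
  stays above the barrier \<open>l\<close>. The recurrence turns the derivative of \<open>H\<close>
  into \<open>?N\<close> times the subsolution slack minus \<open>(l x / x) * H x\<close>, which is
  positive where \<open>H\<close> is negative. The differential hypotheses concern only the open
  interval, so the comparison may start at 0, where the equation is singular.\<close>

lemma riccati_comparison:
  assumes r: "0 \<le> r" and c: "0 \<le> c" "c \<le> d" and cont: "continuous_on {c..d} l"
    and init: "l c * laplace (r + 1) c \<le> (r + 1/2) * laplace r c"
    and der: "\<And>x. \<lbrakk>c < x; x < d\<rbrakk> \<Longrightarrow> (l has_real_derivative l' x) (at x)"
    and pos: "\<And>x. \<lbrakk>c < x; x < d\<rbrakk> \<Longrightarrow> 0 < l x"
    and sub: "\<And>x. \<lbrakk>c < x; x < d\<rbrakk> \<Longrightarrow> l' x \<le> riccati (r + 1/2) x (l x)"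
  shows "l d * laplace (r + 1) d \<le> (r + 1/2) * laplace r d"
proof -
  define H where "H x = (r + 1/2) * laplace r x - l x * laplace (r + 1) x" for x
  have "0 \<le> H d"
  proof (rule nonneg_by_derivative_sign[OF c(2)])
    show "continuous_on {c..d} H" unfolding H_def
      using c r by (intro continuous_intros cont continuous_on_subset[OF continuous_on_laplace]) auto
    fix x assume x: "c < x" "x < d" and neg: "H x < 0"
    hence x0: "0 < x" using c by linarith
    let ?N = "laplace (r + 1) x"
    define a where "a = r + 1/2"
    have N: "0 < ?N" using r x0 by (simp add: laplace_pos)
    have rec: "laplace (r + 1 + 1) x = ?N - (a * laplace r x - (a + 1/2) * ?N) / x"
      using laplace_recurrence[of r x] r x0 by (simp add: a_def field_simps)
    have "(H has_real_derivative (a * (- ?N) - (l' x * ?N + l x * (- laplace (r + 1 + 1) x)))) (at x)"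
      unfolding H_def a_def using r x0
      by (auto intro!: derivative_eq_intros laplace_has_derivative der x)
    also have "a * (- ?N) - (l' x * ?N + l x * (- laplace (r + 1 + 1) x))
      = ?N * (riccati a x (l x) - l' x) + (l x / x) * (- H x)"
      unfolding rec riccati_def H_def a_def[symmetric] using x0 by (simp add: field_simps)
    finally have "(H has_real_derivative ?N * (riccati a x (l x) - l' x) + (l x / x) * (- H x)) (at x)" .
    moreover have "0 \<le> ?N * (riccati a x (l x) - l' x)" using N sub[OF x] by (simp add: a_def)
    moreover have "0 < (l x / x) * (- H x)" using pos[OF x] x0 neg by (intro mult_pos_pos) auto
    ultimately show "\<exists>y. (H has_real_derivative y) (at x) \<and> 0 < y" by (intro exI conjI) auto
  qed (use init in \<open>simp add: H_def\<close>)
  thus ?thesis by (simp add: H_def)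
qed

section \<open>Applying the two barriers to the ratio of transforms\<close>

lemma quad_barrier_has_derivative:
  assumes "0 < a"
  shows "(quad_barrier a has_real_derivative (2 * z - a + 17/10) / (4 * (a + 1/2))) (at z)"
proof -
  define k where "k = 4 * (a + 1/2)"
  have "k \<noteq> 0" using assms by (simp add: k_def)
  thus ?thesis unfolding quad_barrier_def[abs_def] k_def[symmetric]
    by (auto intro!: derivative_eq_intros simp: field_simps)
qed

lemma sqrt_barrier_has_derivative:
  assumes "4 \<le> a" "2 * a + 9/4 \<le> z"
  shows "(sqrt_barrier a has_real_derivative (1 + (z + 1 - a) / sqrt ((z + 1)\<^sup>2 - 2 * a * z)) / 2) (at z)"
  unfolding sqrt_barrier_def[abs_def]
  using discriminant_pos[OF assms]
  by (auto intro!: derivative_eq_intros simp: field_simps)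

lemma laplace_ratio_ge_quad_barrier:
  assumes r: "7/2 \<le> r" and z: "0 \<le> z" "z \<le> 2 * (r + 1/2) + 9/4"
  shows "quad_barrier (r + 1/2) z * laplace (r + 1) z \<le> (r + 1/2) * laplace r z"
proof (rule riccati_comparison[where c = 0])
  show "continuous_on {0..z} (quad_barrier (r + 1/2))"
    using r by (intro DERIV_continuous_on[OF has_field_derivative_at_within[OF quad_barrier_has_derivative]]) auto
  \<comment> \<open>Equality holds at 0: the barrier equals \<open>r + 1\<close> there, and the
    recurrence at \<open>z = 0\<close> gives the same ratio.\<close>
  show "quad_barrier (r + 1/2) 0 * laplace (r + 1) 0 \<le> (r + 1/2) * laplace r 0"
    using laplace_recurrence[of r 0] r by (simp add: quad_barrier_def add.commute)
qed (use r z in \<open>auto intro!: quad_barrier_has_derivative quad_barrier_subsolution quad_barrier_pos\<close>)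

lemma laplace_ratio_risk_poly_nonneg:
  assumes r: "7/2 \<le> r" and z: "0 \<le> z"
  defines "a \<equiv> r + 1/2"
  shows "0 \<le> risk_poly a z (a * laplace r z / laplace (r + 1) z)"
proof -
  have a: "4 \<le> a" using r by (simp add: a_def)
  have N: "0 < laplace (r + 1) z" using r z by (simp add: laplace_pos)
  show ?thesis
  proof (cases "z \<le> 2 * a + 9/4")
    case True
    have "quad_barrier a z \<le> a * laplace r z / laplace (r + 1) z"
      using laplace_ratio_ge_quad_barrier[OF r z] True N by (simp add: a_def pos_le_divide_eq)
    thus ?thesis
      using a z True by (intro risk_poly_mono[OF quad_barrier_risk_poly quad_barrier_ge])
  next
    case False
    define c where "c = 2 * a + 9/4"
    have cz: "c \<le> z" "0 \<le> c" using False a by (auto simp: c_def)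
    \<comment> \<open>At the junction the quadratic barrier is on the increasing branch with a
      nonnegative risk polynomial, hence not below the larger root, so the second comparison can
      start from the first.\<close>
    have sq: "sqrt_barrier a c \<le> quad_barrier a c"
    proof -
      have "0 \<le> 2 * risk_poly a c (quad_barrier a c)"
        using quad_barrier_risk_poly[OF a cz(2)] by (simp add: c_def)
      also have "\<dots> = (2 * quad_barrier a c - (c + 1))^2 - ((c + 1)\<^sup>2 - 2 * a * c)"
        by (simp add: risk_poly_def power2_eq_square algebra_simps)
      finally have "sqrt ((c + 1)\<^sup>2 - 2 * a * c) \<le> 2 * quad_barrier a c - (c + 1)"
        using quad_barrier_ge[OF a, of c] by (intro real_le_lsqrt) auto
      thus ?thesis by (simp add: sqrt_barrier_def)
    qed
    have "sqrt_barrier a z * laplace (r + 1) z \<le> (r + 1/2) * laplace r z"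
    proof (rule riccati_comparison[where c = c])
      show "continuous_on {c..z} (sqrt_barrier a)"
        by (rule DERIV_continuous_on[OF has_field_derivative_at_within[OF sqrt_barrier_has_derivative]])
          (use a in \<open>auto simp: c_def\<close>)
      have "sqrt_barrier a c * laplace (r + 1) c \<le> quad_barrier a c * laplace (r + 1) c"
        using sq r cz laplace_pos[of "r+1" c] by (intro mult_right_mono) auto
      also have "\<dots> \<le> (r + 1/2) * laplace r c"
        unfolding a_def using laplace_ratio_ge_quad_barrier[OF r cz(2)] by (simp add: c_def a_def)
      finally show "sqrt_barrier a c * laplace (r + 1) c \<le> (r + 1/2) * laplace r c" .
      fix x assume x: "c < x" "x < z"
      show "(sqrt_barrier a has_real_derivative (1 + (x + 1 - a) / sqrt ((x + 1)\<^sup>2 - 2 * a * x)) / 2) (at x)"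
        using x a by (intro sqrt_barrier_has_derivative) (auto simp: c_def)
      show "(1 + (x + 1 - a) / sqrt ((x + 1)\<^sup>2 - 2 * a * x)) / 2 \<le> riccati (r + 1/2) x (sqrt_barrier a x)"
        using x a sqrt_barrier_subsolution[of a x] by (simp add: c_def a_def)
      have "0 \<le> sqrt ((x + 1)\<^sup>2 - 2 * a * x)"
        using x a discriminant_pos[of a x] by (intro real_sqrt_ge_zero) (auto simp: c_def)
      thus "0 < sqrt_barrier a x"
        using x a unfolding sqrt_barrier_def c_def by (intro divide_pos_pos add_pos_nonneg) auto
    qed (use r cz in auto)
    hence le: "sqrt_barrier a z \<le> a * laplace r z / laplace (r + 1) z"
      using N by (simp add: a_def pos_le_divide_eq)
    have "z + 1 \<le> 2 * sqrt_barrier a z"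
      using discriminant_pos[of a z] a cz by (simp add: sqrt_barrier_def c_def)
    thus ?thesis
      using a cz by (intro risk_poly_mono[OF _ _ le]) (simp_all add: sqrt_barrier_risk_poly c_def)
  qed
qed

definition mean_kappa :: "real \<Rightarrow> real \<Rightarrow> real" where
  "mean_kappa r z = laplace (r + 1) z / laplace r z"

lemma mean_kappa_bound:
  assumes r: "7/2 \<le> r" and z: "0 \<le> z"
  shows "z * mean_kappa r z * (2 - mean_kappa r z) + 2 * mean_kappa r z \<le> 2 * r + 1"
proof -
  define a where "a = r + 1/2"
  define m where "m = mean_kappa r z"
  have m: "0 < m" using r z by (simp add: m_def mean_kappa_def laplace_pos)
  have a: "0 < a" using r by (simp add: a_def)
  have "a * laplace r z / laplace (r + 1) z = a / m"
    by (simp add: m_def mean_kappa_def)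
  hence "0 \<le> risk_poly a z (a / m)"
    using laplace_ratio_risk_poly_nonneg[OF r z] by (simp add: a_def)
  hence "0 \<le> m^2 * risk_poly a z (a / m)" by simp
  also have "\<dots> = a * (2 * a - 2 * m * (z + 1) + z * m^2)"
    using m by (simp add: risk_poly_def field_simps power2_eq_square)
  finally have "0 \<le> 2 * a - 2 * m * (z + 1) + z * m^2" using a by (simp add: zero_le_mult_iff)
  thus ?thesis unfolding m_def[symmetric] by (simp add: a_def algebra_simps power2_eq_square)
qed

section \<open>Gaussian integrals\<close>

text \<open>Brings coordinate products into the form to which the product formula for
  \<open>lborel\<close> integrals over \<open>Basis\<close> applies.\<close>

lemma prod_vec_nth_eq_prod_Basis:
  fixes x :: "real ^ 'p"
  shows "(\<Prod>i\<in>UNIV. f (axis i 1) (x $ i)) = (\<Prod>b\<in>Basis. f b (x \<bullet> b))"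
proof -
  have "bij_betw (\<lambda>i. axis i (1::real)) UNIV (Basis :: (real ^ 'p) set)"
    by (auto simp: bij_betw_def inj_on_def axis_eq_axis Basis_vec_def)
  from prod.reindex_bij_betw[OF this, of "\<lambda>b. f b (x \<bullet> b)"]
  show ?thesis by (simp add: inner_axis)
qed

lemma power2_norm_vec: "(norm (x :: real ^ 'p))\<^sup>2 = (\<Sum>i\<in>UNIV. (x $ i)\<^sup>2)"
  unfolding power2_norm_eq_inner inner_vec_def by (simp add: power2_eq_square)

lemma mvn_density_eq:
  fixes \<mu> x :: "real ^ 'p"
  assumes "0 < v"
  shows "mvn_density \<mu> v x = (1 / sqrt (2 * pi * v)) ^ CARD('p) * exp (- (norm (x - \<mu>))\<^sup>2 / (2 * v))"
proof -
  have "mvn_density \<mu> v x = (\<Prod>i\<in>UNIV. 1 / sqrt (2 * pi * v) * exp (- (x $ i - \<mu> $ i)\<^sup>2 / (2 * v)))"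
    using assms by (simp add: mvn_density_def normal_density_def)
  also have "\<dots> = (1 / sqrt (2 * pi * v)) ^ CARD('p) * exp (\<Sum>i\<in>UNIV. - (x $ i - \<mu> $ i)\<^sup>2 / (2 * v))"
    by (simp only: prod.distrib exp_sum[OF finite] prod_constant)
  also have "(\<Sum>i\<in>UNIV. - (x $ i - \<mu> $ i)\<^sup>2 / (2 * v)) = - (norm (x - \<mu>))\<^sup>2 / (2 * v)"
    by (simp add: power2_norm_vec sum_negf sum_divide_distrib)
  finally show ?thesis .
qed

lemma mvn_density_nonneg: "0 \<le> mvn_density \<mu> v x"
  by (simp add: mvn_density_def prod_nonneg)

lemma borel_measurable_vec_nth [measurable]: "(\<lambda>x::real ^ 'p. x $ i) \<in> borel_measurable borel"
  by (intro borel_measurable_continuous_onI continuous_intros)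

lemma mvn_density_measurable [measurable (raw)]:
  assumes [measurable]: "m \<in> borel_measurable M" "v \<in> borel_measurable M" "x \<in> borel_measurable M"
  shows "(\<lambda>\<omega>. mvn_density (m \<omega>) (v \<omega>) (x \<omega> :: real ^ 'p)) \<in> borel_measurable M"
  unfolding mvn_density_def normal_density_def by measurable

lemma normal_density_abs: "normal_density \<mu> \<bar>\<sigma>\<bar> = normal_density \<mu> \<sigma>"
  by (simp add: normal_density_def fun_eq_iff)

text \<open>All real \<sigma> are covered because the mixture kernel is defined for every real
  \<kappa>. A negative variance gives a negative \<open>sqrt\<close>, on whose sign the density does
  not depend; for \<open>\<sigma> = 0\<close> division by zero makes the density 0.\<close>

lemma nn_integral_normal_density:
  "(\<integral>\<^sup>+t. ennreal (normal_density \<mu> \<sigma> t) \<partial>lborel) = (if \<sigma> = 0 then 0 else 1)"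
proof (cases "\<sigma> = 0")
  case False
  hence "(\<integral>\<^sup>+t. ennreal (normal_density \<mu> \<bar>\<sigma>\<bar> t) \<partial>lborel) = ennreal 1"
    by (subst nn_integral_eq_integral) (auto simp: integral_normal_density)
  thus ?thesis using False by (simp add: normal_density_abs)
qed (simp add: normal_density_def)

lemma nn_integral_mvn_density:
  fixes \<mu> :: "real ^ 'p"
  shows "(\<integral>\<^sup>+x. ennreal (mvn_density \<mu> v x) \<partial>lborel) = (if v = 0 then 0 else 1)"
proof -
  have "mvn_density \<mu> v x = (\<Prod>b\<in>Basis. normal_density (\<mu> \<bullet> b) (sqrt v) (x \<bullet> b))" for x
    using prod_vec_nth_eq_prod_Basis[of "\<lambda>b. normal_density (\<mu> \<bullet> b) (sqrt v)" x]
    by (simp add: mvn_density_def inner_axis)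
  hence "(\<integral>\<^sup>+x. ennreal (mvn_density \<mu> v x) \<partial>lborel)
      = (\<integral>\<^sup>+x. (\<Prod>b\<in>Basis. ennreal (normal_density (\<mu> \<bullet> b) (sqrt v) (x \<bullet> b))) \<partial>lborel)"
    by (simp add: prod_ennreal)
  also have "\<dots> = (\<Prod>b\<in>Basis. (\<integral>\<^sup>+t. ennreal (normal_density (\<mu> \<bullet> b) (sqrt v) t) \<partial>lborel))"
    by (rule nn_integral_lborel_prod) auto
  also have "\<dots> = (if v = 0 then 0 else 1)" by (simp add: nn_integral_normal_density)
  finally show ?thesis .
qed

lemma nn_integral_normal_density_second_moment:
  assumes "0 < \<sigma>"
  shows "(\<integral>\<^sup>+t. ennreal (normal_density \<mu> \<sigma> t * (t - \<mu>)\<^sup>2) \<partial>lborel) = ennreal (\<sigma>\<^sup>2)"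
  using normal_moment_even[of \<sigma> \<mu> 1] assms
  by (subst nn_integral_eq_integral)
    (auto simp: has_bochner_integral_iff fact_numeral)

lemma nn_integral_mvn_second_moment:
  fixes \<mu> :: "real ^ 'p"
  assumes v: "0 < v"
  shows "(\<integral>\<^sup>+x. ennreal (mvn_density \<mu> v x * (norm (x - \<mu>))\<^sup>2) \<partial>lborel) = ennreal (real CARD('p) * v)"
proof -
  have coord: "(\<integral>\<^sup>+x. ennreal (mvn_density \<mu> v x * (x $ i - \<mu> $ i)\<^sup>2) \<partial>lborel) = ennreal v" for i
  proof -
    define e where "e = (axis i 1 :: real ^ 'p)"
    \<comment> \<open>Attaching the squared deviation to the single factor \<open>e\<close> keeps
      the integrand a product over coordinates.\<close>
    define g where "g b t = normal_density (\<mu> \<bullet> b) (sqrt v) t * (if b = e then (t - \<mu> \<bullet> b)\<^sup>2 else 1)" for b t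
    have e: "e \<in> Basis" by (auto simp: e_def Basis_vec_def)
    have "mvn_density \<mu> v x * (x $ i - \<mu> $ i)\<^sup>2 = (\<Prod>j\<in>UNIV. g (axis j 1) (x $ j))" for x
      by (simp add: mvn_density_def inner_axis g_def prod.distrib e_def axis_eq_axis prod.delta cong: if_cong)
    hence "mvn_density \<mu> v x * (x $ i - \<mu> $ i)\<^sup>2 = (\<Prod>b\<in>Basis. g b (x \<bullet> b))" for x
      using prod_vec_nth_eq_prod_Basis[of g x] by simp
    moreover have nn: "0 \<le> g b t" for b t by (simp add: g_def)
    ultimately have "(\<integral>\<^sup>+x. ennreal (mvn_density \<mu> v x * (x $ i - \<mu> $ i)\<^sup>2) \<partial>lborel)
       = (\<integral>\<^sup>+x. (\<Prod>b\<in>Basis. ennreal (g b (x \<bullet> b))) \<partial>lborel)"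
      by (simp add: prod_ennreal)
    also have "\<dots> = (\<Prod>b\<in>Basis. (\<integral>\<^sup>+t. ennreal (g b t) \<partial>lborel))"
      by (rule nn_integral_lborel_prod) (auto simp: g_def)
    also have "\<dots> = (\<Prod>b\<in>Basis. if b = e then ennreal v else 1)"
      using v by (intro prod.cong refl)
        (auto simp: g_def nn_integral_normal_density nn_integral_normal_density_second_moment)
    also have "\<dots> = ennreal v" using e by (simp add: prod.delta)
    finally show ?thesis .
  qed
  have "(\<integral>\<^sup>+x. ennreal (mvn_density \<mu> v x * (norm (x - \<mu>))\<^sup>2) \<partial>lborel)
     = (\<integral>\<^sup>+x. (\<Sum>i\<in>UNIV. ennreal (mvn_density \<mu> v x * (x $ i - \<mu> $ i)\<^sup>2)) \<partial>lborel)"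
    by (simp add: power2_norm_vec sum_distrib_left sum_ennreal mvn_density_nonneg)
  also have "\<dots> = (\<Sum>i::'p\<in>UNIV. ennreal v)"
    by (subst nn_integral_sum) (auto simp: coord)
  finally show ?thesis using v by (simp add: ennreal_mult ennreal_of_nat_eq_real_of_nat)
qed

section \<open>Affine substitution, reflection and conjugacy\<close>

lemma nn_integral_lborel_affine:
  fixes t :: "'a::euclidean_space"
  assumes "c \<noteq> 0" and [measurable]: "f \<in> borel_measurable borel"
  shows "(\<integral>\<^sup>+x. f x \<partial>lborel) = ennreal (\<bar>c\<bar> ^ DIM('a)) * (\<integral>\<^sup>+x. f (t + c *\<^sub>R x) \<partial>lborel)"
  by (subst lborel_affine[OF assms(1), of t])
    (simp add: nn_integral_density nn_integral_distr nn_integral_cmult)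

lemma
  fixes t :: "'a::euclidean_space" and f :: "'a \<Rightarrow> 'b::{banach, second_countable_topology}"
  assumes c: "c \<noteq> 0" and [measurable]: "f \<in> borel_measurable borel"
  shows integrable_lborel_affine: "integrable lborel (\<lambda>x. f (t + c *\<^sub>R x)) \<longleftrightarrow> integrable lborel f"
    and integral_lborel_affine: "integral\<^sup>L lborel f = \<bar>c\<bar> ^ DIM('a) *\<^sub>R (\<integral>x. f (t + c *\<^sub>R x) \<partial>lborel)"
proof -
  have "integrable lborel f \<longleftrightarrow> integrable (density (distr lborel borel (\<lambda>x. t + c *\<^sub>R x)) (\<lambda>_. \<bar>c\<bar> ^ DIM('a))) f"
    using lborel_affine[OF c, of t] by simp
  also have "\<dots> \<longleftrightarrow> integrable (distr lborel borel (\<lambda>x. t + c *\<^sub>R x)) (\<lambda>x. \<bar>c\<bar> ^ DIM('a) *\<^sub>R f x)"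
    by (subst integrable_density) auto
  also have "\<dots> \<longleftrightarrow> integrable lborel (\<lambda>x. f (t + c *\<^sub>R x))"
  proof -
    have "integrable lborel (\<lambda>x. k *\<^sub>R h x) \<longleftrightarrow> integrable lborel h" if "k \<noteq> 0" for k and h :: "'a \<Rightarrow> 'b"
      using that integrable_scaleR_right[of k lborel h] integrable_scaleR_right[of "inverse k" lborel "\<lambda>x. k *\<^sub>R h x"]
      by auto
    thus ?thesis using c by (simp add: integrable_distr_eq)
  qed
  finally show "integrable lborel (\<lambda>x. f (t + c *\<^sub>R x)) \<longleftrightarrow> integrable lborel f" by simp
  have "integral\<^sup>L lborel f = integral\<^sup>L (density (distr lborel borel (\<lambda>x. t + c *\<^sub>R x)) (\<lambda>_. \<bar>c\<bar> ^ DIM('a))) f"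
    using lborel_affine[OF c, of t] by simp
  also have "\<dots> = integral\<^sup>L (distr lborel borel (\<lambda>x. t + c *\<^sub>R x)) (\<lambda>x. \<bar>c\<bar> ^ DIM('a) *\<^sub>R f x)"
    by (subst integral_density) auto
  also have "\<dots> = \<bar>c\<bar> ^ DIM('a) *\<^sub>R (\<integral>x. f (t + c *\<^sub>R x) \<partial>lborel)"
    by (simp add: integral_distr)
  finally show "integral\<^sup>L lborel f = \<bar>c\<bar> ^ DIM('a) *\<^sub>R (\<integral>x. f (t + c *\<^sub>R x) \<partial>lborel)" .
qed

lemma mvn_density_reflect: "mvn_density \<mu> v (2 *\<^sub>R \<mu> - x) = mvn_density \<mu> v x"
  by (simp add: mvn_density_def normal_density_def power2_commute)

text \<open>Averaging over the reflection of \<open>x\<close> in \<open>\<mu>\<close> and the parallelogram law show that the mean is the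
  best constant predictor without splitting any integral, so no integrability is needed.\<close>

lemma nn_integral_mvn_dist_ge:
  fixes a \<mu> :: "real ^ 'p"
  assumes v: "0 < v"
  shows "ennreal (real CARD('p) * v) \<le> (\<integral>\<^sup>+x. ennreal (mvn_density \<mu> v x * (norm (a - x))\<^sup>2) \<partial>lborel)"
    (is "_ \<le> ?I")
proof -
  have "?I = (\<integral>\<^sup>+x. ennreal (mvn_density \<mu> v (2 *\<^sub>R \<mu> - x) * (norm (a - (2 *\<^sub>R \<mu> - x)))\<^sup>2) \<partial>lborel)"
    by (subst nn_integral_lborel_affine[of "-1" _ "2 *\<^sub>R \<mu>"]) auto
  hence "?I + ?I = (\<integral>\<^sup>+x. ennreal (mvn_density \<mu> v x * (norm (a - x))\<^sup>2)
      + ennreal (mvn_density \<mu> v x * (norm (a - (2 *\<^sub>R \<mu> - x)))\<^sup>2) \<partial>lborel)"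
    by (simp add: nn_integral_add mvn_density_reflect)
  also have "\<dots> \<ge> (\<integral>\<^sup>+x. 2 * ennreal (mvn_density \<mu> v x * (norm (x - \<mu>))\<^sup>2) \<partial>lborel)"
  proof (rule nn_integral_mono)
    fix x
    have "2 * (norm (x - \<mu>))\<^sup>2 \<le> (norm (a - x))\<^sup>2 + (norm (a - (2 *\<^sub>R \<mu> - x)))\<^sup>2"
    proof -
      have "(norm (a - x))\<^sup>2 + (norm (a - (2 *\<^sub>R \<mu> - x)))\<^sup>2 = 2 * (norm (x - \<mu>))\<^sup>2 + 2 * (norm (a - \<mu>))\<^sup>2"
        by (simp add: power2_norm_eq_inner inner_diff_left inner_diff_right inner_commute algebra_simps)
      thus ?thesis by simp
    qed
    hence "mvn_density \<mu> v x * (2 * (norm (x - \<mu>))\<^sup>2)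
        \<le> mvn_density \<mu> v x * ((norm (a - x))\<^sup>2 + (norm (a - (2 *\<^sub>R \<mu> - x)))\<^sup>2)"
      by (intro mult_left_mono mvn_density_nonneg)
    hence "ennreal (2 * (mvn_density \<mu> v x * (norm (x - \<mu>))\<^sup>2))
       \<le> ennreal (mvn_density \<mu> v x * (norm (a - x))\<^sup>2 + mvn_density \<mu> v x * (norm (a - (2 *\<^sub>R \<mu> - x)))\<^sup>2)"
      by (intro ennreal_leI) (simp add: algebra_simps)
    thus "2 * ennreal (mvn_density \<mu> v x * (norm (x - \<mu>))\<^sup>2) \<le> ennreal (mvn_density \<mu> v x * (norm (a - x))\<^sup>2)
      + ennreal (mvn_density \<mu> v x * (norm (a - (2 *\<^sub>R \<mu> - x)))\<^sup>2)"
      by (simp add: ennreal_mult mvn_density_nonneg)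
  qed
  also have "(\<integral>\<^sup>+x. 2 * ennreal (mvn_density \<mu> v x * (norm (x - \<mu>))\<^sup>2) \<partial>lborel)
     = 2 * ennreal (real CARD('p) * v)"
    using v by (simp add: nn_integral_cmult nn_integral_mvn_second_moment)
  finally have "2 * ennreal (real CARD('p) * v) \<le> 2 * ?I" by (simp add: mult_2)
  thus ?thesis by (subst (asm) ennreal_mult_le_mult_iff) auto
qed

lemma integrable_mvn_density:
  fixes \<mu> :: "real ^ 'p"
  assumes v: "0 < v"
  shows "integrable lborel (mvn_density \<mu> v)" and "integral\<^sup>L lborel (mvn_density \<mu> v) = 1"
proof -
  have "(\<integral>\<^sup>+x. ennreal (mvn_density \<mu> v x) \<partial>lborel) = ennreal 1"
    using v by (simp add: nn_integral_mvn_density)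
  thus "integrable lborel (mvn_density \<mu> v)" "integral\<^sup>L lborel (mvn_density \<mu> v) = 1"
    by (auto intro!: integrableI_nn_integral_finite integral_eq_nn_integral[THEN trans]
      simp: mvn_density_nonneg)
qed

lemma integrable_mvn_second_moment:
  fixes \<mu> :: "real ^ 'p"
  assumes v: "0 < v"
  shows "integrable lborel (\<lambda>x. mvn_density \<mu> v x * (norm (x - \<mu>))\<^sup>2)"
    and "(\<integral>x. mvn_density \<mu> v x * (norm (x - \<mu>))\<^sup>2 \<partial>lborel) = real CARD('p) * v"
  using nn_integral_mvn_second_moment[OF v, of \<mu>] v
  by (auto intro!: integrableI_nn_integral_finite integral_eq_nn_integral[THEN trans]
      simp: mvn_density_nonneg)

text \<open>The centred integrand is odd under reflection in \<mu>, so its integral is its own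
  negative. Integrability comes from bounding a norm by 1 plus its square.\<close>

lemma integrable_mvn_mean:
  fixes \<mu> :: "real ^ 'p"
  assumes v: "0 < v"
  shows "integrable lborel (\<lambda>x. mvn_density \<mu> v x *\<^sub>R x)"
    and "(\<integral>x. mvn_density \<mu> v x *\<^sub>R x \<partial>lborel) = \<mu>"
proof -
  define g where "g x = mvn_density \<mu> v x *\<^sub>R (x - \<mu>)" for x
  have [measurable]: "g \<in> borel_measurable borel" unfolding g_def by measurable
  have gi: "integrable lborel g"
  proof (rule Bochner_Integration.integrable_bound)
    show "integrable lborel (\<lambda>x. mvn_density \<mu> v x + mvn_density \<mu> v x * (norm (x - \<mu>))\<^sup>2)"
      using v by (intro Bochner_Integration.integrable_add integrable_mvn_density integrable_mvn_second_moment)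
    have "norm (x - \<mu>) \<le> 1 + (norm (x - \<mu>))\<^sup>2" for x
      using zero_le_power2[of "norm (x - \<mu>) - 1/2"] by (simp add: power2_eq_square field_simps)
    from mult_left_mono[OF this mvn_density_nonneg]
    show "AE x in lborel. norm (g x) \<le> norm (mvn_density \<mu> v x + mvn_density \<mu> v x * (norm (x - \<mu>))\<^sup>2)"
      by (intro AE_I2) (simp add: g_def mvn_density_nonneg distrib_left)
  qed simp
  have "integral\<^sup>L lborel g = (\<integral>x. g (2 *\<^sub>R \<mu> - x) \<partial>lborel)"
    by (subst integral_lborel_affine[of "-1" _ "2 *\<^sub>R \<mu>"]) auto
  also have "\<dots> = (\<integral>x. - g x \<partial>lborel)"
    unfolding g_def mvn_density_reflect scaleR_minus_right[symmetric] by (simp add: scaleR_2)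
  finally have "2 *\<^sub>R integral\<^sup>L lborel g = 0" by (simp add: scaleR_2 eq_neg_iff_add_eq_0)
  hence g0: "integral\<^sup>L lborel g = 0" by simp
  have eq: "(\<lambda>x. mvn_density \<mu> v x *\<^sub>R x) = (\<lambda>x. g x + mvn_density \<mu> v x *\<^sub>R \<mu>)"
    by (simp add: g_def scaleR_diff_right)
  show "integrable lborel (\<lambda>x. mvn_density \<mu> v x *\<^sub>R x)"
    unfolding eq by (intro Bochner_Integration.integrable_add integrable_scaleR_left gi integrable_mvn_density v)
  show "(\<integral>x. mvn_density \<mu> v x *\<^sub>R x \<partial>lborel) = \<mu>"
    unfolding eq using v gi g0 integrable_mvn_density[OF v, of \<mu>] by simp
qed

text \<open>Completing the square in \<open>b\<close>: likelihood times prior equals the marginal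
  density of \<open>y\<close> times the conditional density of \<open>b\<close> given
  \<open>y\<close>, with shrinkage factor \<open>c\<close>. Both the posterior mean and the Bayes
  risk bound rest on it.\<close>

lemma mvn_density_mult:
  fixes y b :: "real ^ 'p"
  assumes v: "0 < v"
  defines "c \<equiv> v / (1 + v)"
  shows "mvn_density b 1 y * mvn_density 0 v b = mvn_density 0 (1 + v) y * mvn_density (c *\<^sub>R y) c b"
proof -
  have c: "0 < c" using v by (simp add: c_def)
  have one: "1 / sqrt (2 * pi * 1) * (1 / sqrt (2 * pi * v)) = 1 / sqrt (2 * pi * (1 + v)) * (1 / sqrt (2 * pi * c))"
    using v by (simp add: c_def real_sqrt_mult real_sqrt_divide)
  have "(norm (y - b))\<^sup>2 / 2 + (norm b)\<^sup>2 / (2 * v) = (norm y)\<^sup>2 / (2 * (1 + v)) + (norm (b - c *\<^sub>R y))\<^sup>2 / (2 * c)"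
  proof -
    have "(norm b)\<^sup>2 / (2 * v) = (b \<bullet> b) / (2 * c) - (b \<bullet> b) / 2"
      and "(norm y)\<^sup>2 / (2 * (1 + v)) = (y \<bullet> y) / 2 - c * (y \<bullet> y) / 2"
      using v by (simp_all add: c_def power2_norm_eq_inner field_simps)
    moreover have "(norm (b - c *\<^sub>R y))\<^sup>2 / (2 * c) = (b \<bullet> b) / (2 * c) - b \<bullet> y + c * (y \<bullet> y) / 2"
      using c by (simp add: power2_norm_eq_inner inner_diff_left inner_diff_right inner_commute field_simps)
    moreover have "(norm (y - b))\<^sup>2 / 2 = (y \<bullet> y) / 2 - b \<bullet> y + (b \<bullet> b) / 2"
      by (simp add: power2_norm_eq_inner inner_diff_left inner_diff_right inner_commute field_simps)
    ultimately show ?thesis by linarith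
  qed
  hence "exp (- (norm (y - b))\<^sup>2 / (2 * 1)) * exp (- (norm (b - 0))\<^sup>2 / (2 * v))
      = exp (- (norm (y - 0))\<^sup>2 / (2 * (1 + v))) * exp (- (norm (b - c *\<^sub>R y))\<^sup>2 / (2 * c))"
    unfolding exp_add[symmetric] by simp
  moreover have "(1 / sqrt (2 * pi * 1)) ^ CARD('p) * (1 / sqrt (2 * pi * v)) ^ CARD('p)
      = (1 / sqrt (2 * pi * (1 + v))) ^ CARD('p) * (1 / sqrt (2 * pi * c)) ^ CARD('p)"
    unfolding power_mult_distrib[symmetric] one ..
  ultimately show ?thesis
    using v c by (simp only: mvn_density_eq zero_less_one add_pos_pos mult.assoc mult.left_commute) (simp add: ac_simps)
qed

section \<open>The posterior mean\<close>

lemma sets_mvn [simp, measurable_cong]: "sets (mvn \<mu> v) = sets borel"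
  by (simp add: mvn_def)

lemma space_mvn [simp]: "space (mvn \<mu> v) = UNIV"
  by (simp add: mvn_def)

lemma nn_integral_mvn:
  fixes \<mu> :: "real ^ 'p"
  assumes [measurable]: "f \<in> borel_measurable borel"
  shows "(\<integral>\<^sup>+x. f x \<partial>mvn \<mu> v) = (\<integral>\<^sup>+x. ennreal (mvn_density \<mu> v x) * f x \<partial>lborel)"
  by (simp add: mvn_def nn_integral_density)

lemma emeasure_mvn_space:
  fixes \<mu> :: "real ^ 'p"
  shows "emeasure (mvn \<mu> v) UNIV = (if v = 0 then 0 else 1)"
  by (simp add: mvn_def emeasure_density nn_integral_mvn_density)

text \<open>Only subprobability holds for all \<kappa>: at \<open>\<kappa> = 0\<close> and
  \<open>\<kappa> = 1\<close> the variance evaluates to 0 and the kernel is the zero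
  measure.\<close>

lemma mixture_kernel_measurable [measurable]:
  "(\<lambda>\<kappa>. mvn (0 :: real ^ 'p) ((1 - \<kappa>) / \<kappa>)) \<in> half_cauchy_kappa \<rightarrow>\<^sub>M subprob_algebra borel"
proof (rule measurable_subprob_algebra)
  fix \<kappa> :: real
  show "subprob_space (mvn (0 :: real ^ 'p) ((1 - \<kappa>) / \<kappa>))"
    by (rule subprob_spaceI) (simp_all add: emeasure_mvn_space)
  fix A :: "(real ^ 'p) set" assume [measurable]: "A \<in> sets borel"
  show "(\<lambda>\<kappa>. emeasure (mvn (0 :: real ^ 'p) ((1 - \<kappa>) / \<kappa>)) A) \<in> borel_measurable half_cauchy_kappa"
    by (simp add: mvn_def emeasure_density) measurable
qed simp

lemma sets_mixture_prior [simp, measurable_cong]: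
  "sets (mixture_prior half_cauchy_kappa :: (real ^ 'p) measure) = sets borel"
  unfolding mixture_prior_def by (subst sets_bind[where N = borel]) auto

lemma finite_measure_mixture_prior:
  "finite_measure (mixture_prior half_cauchy_kappa :: (real ^ 'p) measure)"
  unfolding mixture_prior_def
  by (rule subprob_space.axioms(1), rule subprob_space_bind[where N = borel])
    (auto intro: prob_space_imp_subprob_space half_cauchy.prob_space_axioms)

lemma integral_mixture_prior:
  fixes f :: "real ^ 'p \<Rightarrow> real"
  assumes "f \<in> borel_measurable borel" "\<And>x. \<bar>f x\<bar> \<le> B"
  shows "integrable (mixture_prior half_cauchy_kappa) f"
    and "integral\<^sup>L (mixture_prior half_cauchy_kappa) f
      = (\<integral>\<kappa>. integral\<^sup>L (mvn 0 ((1 - \<kappa>) / \<kappa>)) f \<partial>half_cauchy_kappa)"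
  using integrable_bind[of f borel B "\<lambda>\<kappa>. mvn 0 ((1 - \<kappa>) / \<kappa>)" half_cauchy_kappa 1]
    integral_bind[of f borel B "\<lambda>\<kappa>. mvn 0 ((1 - \<kappa>) / \<kappa>)" half_cauchy_kappa 1] assms
    half_cauchy.finite_measure_axioms
  by (auto simp: mixture_prior_def emeasure_mvn_space)

lemma mvn_density_le:
  fixes b y :: "real ^ 'p"
  shows "mvn_density b 1 y \<le> (1 / sqrt (2 * pi)) ^ CARD('p)"
  by (simp add: mvn_density_eq mult_left_le)

text \<open>Makes the numerator of the posterior mean a bounded integrand, so that
  \<open>integral_mixture_prior\<close> applies to it. The Gaussian factor controls the distance
  from \<open>y\<close> because \<open>t * exp (- t^2 / 2) \<le> 1\<close>.\<close>

lemma norm_mvn_density_le: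
  fixes b y :: "real ^ 'p"
  shows "mvn_density b 1 y * norm b \<le> (1 / sqrt (2 * pi)) ^ CARD('p) * (norm y + 1)"
proof -
  define t where "t = norm (y - b)"
  have tri: "norm b \<le> norm y + t" unfolding t_def using norm_triangle_ineq4[of y "y - b"] by simp
  have "t * exp (- t\<^sup>2 / 2) \<le> 1"
  proof -
    have "t \<le> 1 + t\<^sup>2 / 2" using zero_le_power2[of "t - 1"] by (simp add: power2_eq_square algebra_simps)
    also have "\<dots> \<le> exp (t\<^sup>2 / 2)" by (rule exp_ge_add_one_self)
    finally have "t * exp (- t\<^sup>2 / 2) \<le> exp (t\<^sup>2 / 2) * exp (- t\<^sup>2 / 2)" by (intro mult_right_mono) auto
    thus ?thesis by (simp add: exp_add[symmetric])
  qed
  moreover have "exp (- t\<^sup>2 / 2) * norm y \<le> norm y" by (simp add: mult_left_le_one_le)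
  ultimately have "exp (- t\<^sup>2 / 2) * norm b \<le> norm y + 1"
    using mult_left_mono[OF tri exp_ge_zero[of "- t\<^sup>2 / 2"]]
    unfolding distrib_left mult.commute[of _ t] by linarith
  hence "(1 / sqrt (2 * pi)) ^ CARD('p) * (exp (- t\<^sup>2 / 2) * norm b) \<le> (1 / sqrt (2 * pi)) ^ CARD('p) * (norm y + 1)"
    by (intro mult_left_mono) auto
  thus ?thesis by (simp add: mvn_density_eq t_def mult.assoc)
qed

lemma integral_mvn:
  fixes f :: "real ^ 'p \<Rightarrow> 'b::{banach, second_countable_topology}"
  assumes [measurable]: "f \<in> borel_measurable borel"
  shows "integral\<^sup>L (mvn \<mu> v) f = (\<integral>x. mvn_density \<mu> v x *\<^sub>R f x \<partial>lborel)"
  unfolding mvn_def by (subst integral_density) (auto simp: mvn_density_nonneg)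

text \<open>Given \<kappa>, the observation has variance \<open>1 / \<kappa>\<close>; its density is
  a constant times the integrand of \<open>laplace\<close> at
  \<open>r = CARD('p) / 2\<close>.\<close>

lemma mvn_density_mixture:
  fixes y :: "real ^ 'p"
  assumes \<kappa>: "0 < \<kappa>" "\<kappa> < 1"
  shows "mvn_density 0 (1 + (1 - \<kappa>) / \<kappa>) y
    = (1 / sqrt (2 * pi)) ^ CARD('p) * (\<kappa> powr (real CARD('p) / 2) * exp (- (\<kappa> * ((norm y)\<^sup>2 / 2))))"
proof -
  have v: "1 + (1 - \<kappa>) / \<kappa> = 1 / \<kappa>" using \<kappa> by (simp add: field_simps)
  have "sqrt \<kappa> ^ CARD('p) = \<kappa> powr (real CARD('p) / 2)"
    using \<kappa> by (simp add: powr_half_sqrt[symmetric] powr_realpow[symmetric] powr_powr)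
  moreover have "1 / sqrt (2 * pi * (1 / \<kappa>)) = 1 / sqrt (2 * pi) * sqrt \<kappa>"
    using \<kappa> by (simp add: real_sqrt_mult real_sqrt_divide)
  moreover have "mvn_density 0 (1 / \<kappa>) y
      = (1 / sqrt (2 * pi * (1 / \<kappa>))) ^ CARD('p) * exp (- (norm (y - 0))\<^sup>2 / (2 * (1 / \<kappa>)))"
    using \<kappa> by (intro mvn_density_eq) simp
  ultimately show ?thesis unfolding v by (simp only: power_mult_distrib) (simp add: mult.commute)
qed

text \<open>For variance \<open>(1 - \<kappa>) / \<kappa>\<close> the shrinkage factor of
  \<open>mvn_density_mult\<close> is \<open>1 - \<kappa>\<close>. The marginal density factors out
  and leaves the mass and the mean of a Gaussian centred at
  \<open>(1 - \<kappa>) *\<^sub>R y\<close>.\<close>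

lemma
  fixes y :: "real ^ 'p"
  assumes \<kappa>: "0 < \<kappa>" "\<kappa> < 1"
  shows integral_mvn_likelihood: "(\<integral>b. mvn_density b 1 y \<partial>mvn 0 ((1 - \<kappa>) / \<kappa>))
      = mvn_density 0 (1 + (1 - \<kappa>) / \<kappa>) y" (is ?A)
    and integral_mvn_likelihood_mean: "(\<integral>b. mvn_density b 1 y * b $ i \<partial>mvn 0 ((1 - \<kappa>) / \<kappa>))
      = mvn_density 0 (1 + (1 - \<kappa>) / \<kappa>) y * ((1 - \<kappa>) * y $ i)" (is ?B)
proof -
  define v where "v = (1 - \<kappa>) / \<kappa>"
  have v: "0 < v" and c: "v / (1 + v) = 1 - \<kappa>" "0 < 1 - \<kappa>" using \<kappa> by (simp_all add: v_def field_simps)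
  have *: "mvn_density 0 v b * mvn_density b 1 y = mvn_density 0 (1 + v) y * mvn_density ((1 - \<kappa>) *\<^sub>R y) (1 - \<kappa>) b" for b
    using mvn_density_mult[OF v, of b y] by (simp add: c mult.commute)
  show ?A unfolding v_def[symmetric]
    by (simp add: integral_mvn * integrable_mvn_density(2)[OF c(2)])
  have "((\<integral>x. mvn_density ((1 - \<kappa>) *\<^sub>R y) (1 - \<kappa>) x *\<^sub>R x \<partial>lborel)) $ i
      = (\<integral>x. (mvn_density ((1 - \<kappa>) *\<^sub>R y) (1 - \<kappa>) x *\<^sub>R x) $ i \<partial>lborel)"
    by (rule integral_bounded_linear[symmetric, OF bounded_linear_vec_nth integrable_mvn_mean(1)[OF c(2)]])
  hence "(\<integral>x. mvn_density ((1 - \<kappa>) *\<^sub>R y) (1 - \<kappa>) x * x $ i \<partial>lborel) = (1 - \<kappa>) * y $ i"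
    using integrable_mvn_mean(2)[OF c(2), of "(1 - \<kappa>) *\<^sub>R y"] by simp
  thus ?B unfolding v_def[symmetric]
    by (simp add: integral_mvn mult.assoc[symmetric] *) (simp add: mult.assoc)
qed

text \<open>Averages the conditional formulas over \<kappa>; the factor \<open>1 - \<kappa>\<close>
  becomes the difference of two consecutive transforms.\<close>

lemma
  fixes y :: "real ^ 'p"
  defines "C \<equiv> (1 / sqrt (2 * pi)) ^ CARD('p)" and "r \<equiv> real CARD('p) / 2" and "z \<equiv> (norm y)\<^sup>2 / 2"
  shows integral_mixture_likelihood:
      "(\<integral>b. mvn_density b 1 y \<partial>mixture_prior half_cauchy_kappa) = C * laplace r z" (is ?A)
    and integral_mixture_likelihood_mean:
      "(\<integral>b. mvn_density b 1 y * b $ i \<partial>mixture_prior half_cauchy_kappa)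
        = C * ((laplace r z - laplace (r + 1) z) * y $ i)" (is ?B)
proof -
  have rz: "0 \<le> r" "0 \<le> z" by (auto simp: r_def z_def)
  have "(\<integral>b. mvn_density b 1 y \<partial>mixture_prior half_cauchy_kappa)
     = (\<integral>\<kappa>. (\<integral>b. mvn_density b 1 y \<partial>mvn 0 ((1 - \<kappa>) / \<kappa>)) \<partial>half_cauchy_kappa)"
    by (rule integral_mixture_prior[where B = C])
      (auto simp: C_def mvn_density_nonneg intro!: mvn_density_le[simplified])
  also have "\<dots> = (\<integral>\<kappa>. C * (\<kappa> powr r * exp (- (\<kappa> * z))) \<partial>half_cauchy_kappa)"
  proof (rule integral_cong_AE)
    show "AE \<kappa> in half_cauchy_kappa. (\<integral>b. mvn_density b 1 y \<partial>mvn 0 ((1 - \<kappa>) / \<kappa>)) = C * (\<kappa> powr r * exp (- (\<kappa> * z)))"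
      using AE_half_cauchy by eventually_elim
        (simp only: integral_mvn_likelihood mvn_density_mixture C_def r_def z_def)
  qed measurable
  finally show ?A by (simp add: laplace_def)
  have "\<bar>mvn_density b 1 y * b $ i\<bar> \<le> C * (norm y + 1)" for b
  proof -
    have "mvn_density b 1 y * \<bar>b $ i\<bar> \<le> mvn_density b 1 y * norm b"
      by (intro mult_left_mono component_le_norm_cart mvn_density_nonneg)
    thus ?thesis using norm_mvn_density_le[of b y] by (simp add: abs_mult mvn_density_nonneg C_def)
  qed
  hence "(\<integral>b. mvn_density b 1 y * b $ i \<partial>mixture_prior half_cauchy_kappa)
     = (\<integral>\<kappa>. (\<integral>b. mvn_density b 1 y * b $ i \<partial>mvn 0 ((1 - \<kappa>) / \<kappa>)) \<partial>half_cauchy_kappa)"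
    by (intro integral_mixture_prior) auto
  also have "\<dots> = (\<integral>\<kappa>. C * (\<kappa> powr r * exp (- (\<kappa> * z)) - \<kappa> powr (r + 1) * exp (- (\<kappa> * z))) * y $ i \<partial>half_cauchy_kappa)"
  proof (rule integral_cong_AE)
    show "AE \<kappa> in half_cauchy_kappa. (\<integral>b. mvn_density b 1 y * b $ i \<partial>mvn 0 ((1 - \<kappa>) / \<kappa>))
        = C * (\<kappa> powr r * exp (- (\<kappa> * z)) - \<kappa> powr (r + 1) * exp (- (\<kappa> * z))) * y $ i"
      using AE_half_cauchy
    proof eventually_elim
      case (elim \<kappa>)
      show ?case using elim
        by (simp only: integral_mvn_likelihood_mean mvn_density_mixture C_def[symmetric] r_def[symmetric] z_def[symmetric])
          (simp add: powr_add algebra_simps)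
    qed
  qed measurable
  also have "\<dots> = C * (laplace r z - laplace (r + 1) z) * y $ i"
    unfolding laplace_def using rz by (simp add: laplace_integrable Bochner_Integration.integral_diff)
  finally show ?B by (simp add: mult.assoc)
qed

lemma posterior_mean_half_cauchy:
  fixes y :: "real ^ 'p"
  shows "posterior_mean (mixture_prior half_cauchy_kappa) y
    = (1 - mean_kappa (real CARD('p) / 2) ((norm y)\<^sup>2 / 2)) *\<^sub>R y"
proof -
  let ?P = "mixture_prior half_cauchy_kappa :: (real ^ 'p) measure"
  define C where "C = (1 / sqrt (2 * pi)) ^ CARD('p)"
  define r where "r = real CARD('p) / 2"
  define z where "z = (norm y)\<^sup>2 / 2"
  define m where "m = C * laplace r z"
  have L: "0 < laplace r z" by (intro laplace_pos) (auto simp: r_def z_def)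
  have C: "0 < C" by (simp add: C_def)
  have m: "0 < m" using L C by (simp add: m_def)
  interpret finite_measure ?P by (rule finite_measure_mixture_prior)
  have "(\<integral>\<^sup>+b. ennreal (mvn_density b 1 y) \<partial>?P) = ennreal (\<integral>b. mvn_density b 1 y \<partial>?P)"
    by (intro nn_integral_eq_integral integral_mixture_prior[where B = C])
      (auto simp: C_def mvn_density_nonneg intro!: mvn_density_le[simplified])
  also have "\<dots> = ennreal m" unfolding m_def C_def r_def z_def by (subst integral_mixture_likelihood) simp
  finally have "posterior ?P y = density ?P (\<lambda>b. ennreal (mvn_density b 1 y / m))"
    using m by (simp add: posterior_def divide_ennreal mvn_density_nonneg)
  hence "posterior_mean ?P y = (\<integral>b. (mvn_density b 1 y / m) *\<^sub>R b \<partial>?P)"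
    using m unfolding posterior_mean_def
    by (simp only:) (subst integral_density, auto simp: mvn_density_nonneg)
  \<comment> \<open>Integrability allows the coordinate projection to pass under the vector-valued
    integral.\<close>
  moreover have int: "integrable ?P (\<lambda>b. (mvn_density b 1 y / m) *\<^sub>R b)"
  proof (rule integrable_const_bound[where B = "C * (norm y + 1) / m"])
    show "AE b in ?P. norm ((mvn_density b 1 y / m) *\<^sub>R b) \<le> C * (norm y + 1) / m"
      using norm_mvn_density_le[of _ y] m by (intro AE_I2) (simp add: mvn_density_nonneg divide_right_mono C_def)
  qed measurable
  ultimately have "posterior_mean ?P y $ i = (\<integral>b. (mvn_density b 1 y * b $ i) / m \<partial>?P)" for i
    using integral_bounded_linear[OF bounded_linear_vec_nth int, of i] by simp
  also have "\<dots> i = C * ((laplace r z - laplace (r + 1) z) * y $ i) / m" for i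
    unfolding C_def r_def z_def by (simp only: integral_divide_zero integral_mixture_likelihood_mean)
  also have "\<dots> i = (1 - mean_kappa r z) * y $ i" for i
    using L C by (simp add: m_def mean_kappa_def field_simps)
  finally show ?thesis by (simp add: vec_eq_iff r_def z_def)
qed

text \<open>Taken at \<open>r = CARD('p) / 2 + 1\<close> and \<open>r = CARD('p) / 2\<close> these
  are the two integrals in \<open>beta_hat\<close>; the Beta factor cancels in their
  quotient.\<close>

lemma interval_integral_half_cauchy:
  "(LBINT \<kappa>=0..1. \<kappa> powr (r - 1/2) * (1 - \<kappa>) powr (-1/2) * exp (- \<kappa> * t\<^sup>2 / 2))
     = Beta (1/2) (1/2) * laplace r (t\<^sup>2 / 2)"
proof -
  have "laplace r (t\<^sup>2 / 2) = (\<integral>\<kappa>.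
     (indicator {0<..<1} \<kappa> * (\<kappa> powr (-1/2) * (1 - \<kappa>) powr (-1/2) / Beta (1/2) (1/2)))
       *\<^sub>R (\<kappa> powr r * exp (- (\<kappa> * (t\<^sup>2 / 2)))) \<partial>lborel)"
    unfolding laplace_def half_cauchy_kappa_def
    by (rule integral_density) (use half_cauchy_density_nonneg in auto)
  hence "Beta (1/2) (1/2) * laplace r (t\<^sup>2 / 2) = (\<integral>\<kappa>. Beta (1/2) (1/2) *
     ((indicator {0<..<1} \<kappa> * (\<kappa> powr (-1/2) * (1 - \<kappa>) powr (-1/2) / Beta (1/2) (1/2)))
       *\<^sub>R (\<kappa> powr r * exp (- (\<kappa> * (t\<^sup>2 / 2))))) \<partial>lborel)"
    by (simp only: integral_mult_right_zero)
  also have "\<dots> = (\<integral>\<kappa>. indicator {0<..<1} \<kappa> * (\<kappa> powr (r - 1/2) * (1 - \<kappa>) powr (-1/2) * exp (- \<kappa> * t\<^sup>2 / 2)) \<partial>lborel)"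
    using Beta_half_pos powr_add[of _ "-1/2" r]
    by (intro Bochner_Integration.integral_cong refl) (auto simp: indicator_def algebra_simps)
  also have "\<dots> = (LBINT \<kappa>=0..1. \<kappa> powr (r - 1/2) * (1 - \<kappa>) powr (-1/2) * exp (- \<kappa> * t\<^sup>2 / 2))"
    by (simp add: interval_lebesgue_integral_def set_lebesgue_integral_def zero_ereal_def one_ereal_def)
  finally show ?thesis by simp
qed

lemma beta_hat_eq:
  fixes y :: "real ^ 'p"
  shows "beta_hat y = (1 - mean_kappa (real CARD('p) / 2) ((norm y)\<^sup>2 / 2)) *\<^sub>R y"
proof -
  have "real CARD('p) / 2 + 1 - 1/2 = real CARD('p) / 2 + 1/2" by simp
  note * = interval_integral_half_cauchy[of "real CARD('p) / 2 + 1" "norm y", unfolded this]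
    interval_integral_half_cauchy[of "real CARD('p) / 2" "norm y"]
  show ?thesis unfolding beta_hat_def mean_kappa_def * using Beta_half_pos by simp
qed

section \<open>Lower bound for the maximal risk\<close>

lemma risk_eq:
  fixes \<beta> :: "real ^ 'p"
  assumes [measurable]: "\<delta> \<in> borel_measurable borel"
  shows "risk \<beta> \<delta> = (\<integral>\<^sup>+y. ennreal (mvn_density \<beta> 1 y * (norm (\<delta> y - \<beta>))\<^sup>2) \<partial>lborel)"
  by (simp add: risk_def nn_integral_mvn ennreal_mult mvn_density_nonneg)

text \<open>For each \<open>y\<close> the conditional law of the parameter has total variance
  \<open>CARD('p) * c\<close>, which no guess \<open>\<delta> y\<close> can beat. Conjugacy and
  Tonelli turn the average over \<open>y\<close> into the average of the risk over the prior;
  infinite risks are allowed.\<close>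

lemma Bayes_risk_ge:
  fixes \<delta> :: "real ^ 'p \<Rightarrow> real ^ 'p"
  assumes [measurable]: "\<delta> \<in> borel_measurable borel" and v: "0 < v"
  shows "ennreal (real CARD('p) * (v / (1 + v))) \<le> (\<integral>\<^sup>+\<beta>. risk \<beta> \<delta> \<partial>mvn 0 v)"
proof -
  define c where "c = v / (1 + v)"
  have c: "0 < c" using v by (simp add: c_def)
  have meas [measurable]: "(\<lambda>\<beta>. risk \<beta> \<delta>) \<in> borel_measurable borel"
    unfolding risk_eq[OF assms(1)] by measurable
  have "ennreal (real CARD('p) * c) = (\<integral>\<^sup>+y. ennreal (mvn_density (0 :: real ^ 'p) (1 + v) y) * ennreal (real CARD('p) * c) \<partial>lborel)"
    using v by (simp add: nn_integral_multc nn_integral_mvn_density)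
  also have "\<dots> \<le> (\<integral>\<^sup>+y. ennreal (mvn_density 0 (1 + v) y) *
      (\<integral>\<^sup>+\<beta>. ennreal (mvn_density (c *\<^sub>R y) c \<beta> * (norm (\<delta> y - \<beta>))\<^sup>2) \<partial>lborel) \<partial>lborel)"
    by (intro nn_integral_mono mult_left_mono nn_integral_mvn_dist_ge c) simp
  also have "\<dots> = (\<integral>\<^sup>+y. (\<integral>\<^sup>+\<beta>. ennreal (mvn_density 0 v \<beta> * mvn_density \<beta> 1 y * (norm (\<delta> y - \<beta>))\<^sup>2) \<partial>lborel) \<partial>lborel)"
  proof (intro nn_integral_cong)
    fix y
    have "ennreal (mvn_density 0 (1 + v) y) * ennreal (mvn_density (c *\<^sub>R y) c \<beta> * (norm (\<delta> y - \<beta>))\<^sup>2)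
       = ennreal (mvn_density 0 v \<beta> * mvn_density \<beta> 1 y * (norm (\<delta> y - \<beta>))\<^sup>2)" for \<beta>
      using mvn_density_mult[OF v, of \<beta> y]
      by (simp add: c_def[symmetric] mvn_density_nonneg ennreal_mult[symmetric] mult.assoc[symmetric])
        (simp add: mult.commute)
    thus "ennreal (mvn_density 0 (1 + v) y) *
        (\<integral>\<^sup>+\<beta>. ennreal (mvn_density (c *\<^sub>R y) c \<beta> * (norm (\<delta> y - \<beta>))\<^sup>2) \<partial>lborel)
      = (\<integral>\<^sup>+\<beta>. ennreal (mvn_density 0 v \<beta> * mvn_density \<beta> 1 y * (norm (\<delta> y - \<beta>))\<^sup>2) \<partial>lborel)"
      by (simp add: nn_integral_cmult[symmetric])
  qed
  also have "\<dots> = (\<integral>\<^sup>+\<beta>. (\<integral>\<^sup>+y. ennreal (mvn_density 0 v \<beta> * mvn_density \<beta> 1 y * (norm (\<delta> y - \<beta>))\<^sup>2) \<partial>lborel) \<partial>lborel)"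
    by (rule lborel_pair.Fubini') measurable
  also have "\<dots> = (\<integral>\<^sup>+\<beta>. ennreal (mvn_density 0 v \<beta>) * risk \<beta> \<delta> \<partial>lborel)"
    by (simp add: risk_eq mult.assoc ennreal_mult mvn_density_nonneg nn_integral_cmult)
  also have "\<dots> = (\<integral>\<^sup>+\<beta>. risk \<beta> \<delta> \<partial>mvn 0 v)"
    by (simp add: nn_integral_mvn)
  finally show ?thesis by (simp add: c_def)
qed

lemma sup_risk_ge:
  fixes \<delta> :: "real ^ 'p \<Rightarrow> real ^ 'p"
  assumes "\<delta> \<in> borel_measurable borel"
  shows "ennreal (real CARD('p)) \<le> (SUP \<beta>. risk \<beta> \<delta>)" (is "_ \<le> ?S")
proof (cases "?S = top")
  case False
  define s where "s = enn2real ?S"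
  have s: "?S = ennreal s" "0 \<le> s" using False unfolding s_def less_top by (simp_all only: ennreal_enn2real enn2real_nonneg)
  have "c * real CARD('p) \<le> s" if c: "0 < c" "c < 1" for c
  proof -
    \<comment> \<open>The prior variance whose Bayes risk is exactly the fraction \<open>c\<close>
      of the dimension; \<open>c\<close> then tends to 1.\<close>
    define v where "v = c / (1 - c)"
    have v: "0 < v" "v / (1 + v) = c" using c by (simp_all add: v_def field_simps)
    have "ennreal (real CARD('p) * c) \<le> (\<integral>\<^sup>+\<beta>. risk \<beta> \<delta> \<partial>mvn 0 v)"
      using Bayes_risk_ge[OF assms v(1)] v by simp
    also have "\<dots> \<le> (\<integral>\<^sup>+\<beta>. ?S \<partial>mvn (0 :: real ^ 'p) v)" by (intro nn_integral_mono SUP_upper) simp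
    also have "\<dots> = ennreal s" unfolding s(1) using v(1) by (simp add: emeasure_mvn_space)
    finally show ?thesis using s(2) by (simp add: mult.commute)
  qed
  hence "real CARD('p) \<le> s" by (rule field_le_mult_one_interval)
  thus ?thesis unfolding s(1) by (rule ennreal_leI)
qed (simp only: top_greatest)

section \<open>Stein identity and the risk of the estimator\<close>

text \<open>Since \<open>s ^ n * (\<integral>y. f (s y))\<close> does not depend on \<open>s\<close>, the integral of its
  \<open>s\<close>-derivative at \<open>1\<close>, which is the divergence of \<open>y \<mapsto> f y *\<^sub>R y\<close>, vanishes.\<close>

lemma integral_dilation_derivative:
  fixes f :: "'a::euclidean_space \<Rightarrow> real"
  assumes f: "integrable lborel f" and w: "integrable lborel w"
    and k [measurable]: "k 1 \<in> borel_measurable borel"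
    and der: "AE y in lborel. \<forall>s\<in>{1..2}.
      ((\<lambda>s. s ^ DIM('a) * f (s *\<^sub>R y)) has_real_derivative k s y) (at s) \<and> \<bar>k s y\<bar> \<le> w y"
  shows "integrable lborel (k 1)" and "integral\<^sup>L lborel (k 1) = 0"
proof -
  define h where "h s y = s ^ DIM('a) * f (s *\<^sub>R y)" for s y
  define e where "e n = inverse (real (Suc n))" for n
  define D where "D n y = (h (1 + e n) y - h 1 y) / e n" for n y
  have e: "0 < e n" "e n \<le> 1" for n by (auto simp: e_def field_simps)
  have fm [measurable]: "f \<in> borel_measurable borel" using f by simp
  have h_int: "integrable lborel (h s)" "integral\<^sup>L lborel (h s) = integral\<^sup>L lborel f" if "0 < s" for s
    using that integrable_lborel_affine[of s f 0] integral_lborel_affine[of s f 0] f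
    by (simp_all add: h_def[abs_def])
  have D_int: "integral\<^sup>L lborel (D n) = 0" for n
    unfolding D_def using e[of n] h_int[of "1 + e n"] h_int[of 1]
    by (simp add: Bochner_Integration.integral_diff)
  have [measurable]: "D n \<in> borel_measurable borel" for n unfolding D_def h_def by measurable
  have lim: "AE y in lborel. (\<lambda>n. D n y) \<longlonglongrightarrow> k 1 y"
    using der
  proof eventually_elim
    case (elim y)
    hence "((\<lambda>s. h s y) has_real_derivative k 1 y) (at 1)" by (auto simp: h_def)
    hence "((\<lambda>t. (h (1 + t) y - h 1 y) / t) \<longlongrightarrow> k 1 y) (at 0)" by (simp add: DERIV_def)
    moreover have "filterlim e (at 0) sequentially"
      unfolding filterlim_at e_def using LIMSEQ_inverse_real_of_nat by simp
    ultimately show ?case unfolding D_def by (rule filterlim_compose)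
  qed
  have bound: "AE y in lborel. norm (D n y) \<le> w y" for n
    using der
  proof eventually_elim
    case (elim y)
    \<comment> \<open>By the mean value theorem each difference quotient is a value of
      \<open>k\<close> at an intermediate dilation, hence dominated by \<open>w\<close>.\<close>
    have "\<exists>\<xi>>1. \<xi> < 1 + e n \<and> h (1 + e n) y - h 1 y = (1 + e n - 1) * k \<xi> y"
      using e[of n] elim by (intro MVT2) (auto simp: h_def)
    then obtain \<xi> where "1 < \<xi>" "\<xi> < 1 + e n" "h (1 + e n) y - h 1 y = e n * k \<xi> y" by auto
    hence "D n y = k \<xi> y" "\<xi> \<in> {1..2}" using e[of n] by (auto simp: D_def)
    thus ?case using elim by auto
  qed
  show "integrable lborel (k 1)"
    by (rule integrable_dominated_convergence[OF _ _ w lim bound]) measurable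
  have "(\<lambda>n. integral\<^sup>L lborel (D n)) \<longlonglongrightarrow> integral\<^sup>L lborel (k 1)"
    by (rule integral_dominated_convergence[OF _ _ w lim bound]) measurable
  thus "integral\<^sup>L lborel (k 1) = 0" unfolding D_int using LIMSEQ_unique tendsto_const by blast
qed

text \<open>Minus the variance of \<kappa> under the law whose mean is
  \<open>mean_kappa r z\<close>.\<close>

definition mean_kappa_deriv :: "real \<Rightarrow> real \<Rightarrow> real" where
  "mean_kappa_deriv r z = (mean_kappa r z)\<^sup>2 - laplace (r + 2) z / laplace r z"

lemma mean_kappa_has_derivative:
  assumes "0 \<le> r" "0 < z"
  shows "(mean_kappa r has_real_derivative mean_kappa_deriv r z) (at z)"
proof -
  have L: "0 < laplace r z" using assms by (simp add: laplace_pos)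
  have "((\<lambda>z. laplace (r + 1) z / laplace r z) has_real_derivative
     (- laplace (r + 1 + 1) z * laplace r z - laplace (r + 1) z * (- laplace (r + 1) z)) / (laplace r z * laplace r z)) (at z)"
    using L assms by (intro DERIV_divide laplace_has_derivative) auto
  moreover have "(- laplace (r + 1 + 1) z * laplace r z - laplace (r + 1) z * (- laplace (r + 1) z)) / (laplace r z * laplace r z)
      = mean_kappa_deriv r z"
    using L by (simp add: mean_kappa_deriv_def mean_kappa_def field_simps power2_eq_square)
  ultimately show ?thesis by (simp add: mean_kappa_def[abs_def])
qed

lemma mean_kappa_range:
  assumes "0 \<le> r" "0 \<le> z" shows "0 \<le> mean_kappa r z" "mean_kappa r z \<le> 1"
  using laplace_pos[of r z] laplace_pos[of "r+1" z] laplace_antimono_exponent[of r "r+1" z] assms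
  by (simp_all add: mean_kappa_def)

lemma abs_mean_kappa_deriv_le:
  assumes "0 \<le> r" "0 \<le> z" shows "\<bar>mean_kappa_deriv r z\<bar> \<le> 1"
proof -
  have "0 \<le> laplace (r + 2) z / laplace r z" "laplace (r + 2) z / laplace r z \<le> 1"
    using laplace_pos[of r z] laplace_pos[of "r+2" z] laplace_antimono_exponent[of r "r+2" z] assms by simp_all
  moreover have "0 \<le> (mean_kappa r z)\<^sup>2" "(mean_kappa r z)\<^sup>2 \<le> 1"
    using mean_kappa_range[OF assms] by (simp_all add: power_le_one)
  ultimately show ?thesis unfolding mean_kappa_deriv_def by (intro abs_leI) linarith+
qed

lemma laplace_measurable [measurable]: "laplace r \<in> borel_measurable borel"
  unfolding laplace_def by measurable

lemma mean_kappa_measurable [measurable]: "mean_kappa r \<in> borel_measurable borel"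
  unfolding mean_kappa_def[abs_def] by measurable

lemma mean_kappa_deriv_measurable [measurable]: "mean_kappa_deriv r \<in> borel_measurable borel"
  unfolding mean_kappa_deriv_def[abs_def] by measurable

text \<open>The recurrence eliminates \<open>laplace (r + 2)\<close>, after which the slack equals
  that of \<open>mean_kappa_bound\<close>. With \<open>2 * r = CARD('p)\<close> this is the
  pointwise condition for dominating the risk of the identity.\<close>

lemma mean_kappa_risk_ineq:
  assumes r: "7/2 \<le> r" and z: "0 \<le> z"
  shows "z * (mean_kappa r z)\<^sup>2 \<le> 2 * r * mean_kappa r z + 2 * z * mean_kappa_deriv r z"
proof -
  define m where "m = mean_kappa r z"
  define q where "q = laplace (r + 2) z / laplace r z"
  have L: "0 < laplace r z" using r z by (simp add: laplace_pos)
  have "z * (m - q) = z * (laplace (r + 1) z - laplace (r + 2) z) / laplace r z"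
    by (simp add: m_def q_def mean_kappa_def diff_divide_distrib right_diff_distrib)
  also have "\<dots> = (r + 1/2) - (r + 1) * m"
    using laplace_recurrence[of r z] r z L by (simp add: m_def mean_kappa_def diff_divide_distrib)
  finally have "z * q = z * m - (r + 1/2) + (r + 1) * m" by (simp add: algebra_simps)
  hence "2 * r * m + 2 * z * (m\<^sup>2 - q) - z * m\<^sup>2 = 2 * r + 1 - (z * m * (2 - m) + 2 * m)"
    by (simp add: algebra_simps power2_eq_square)
  also have "\<dots> \<ge> 0" using mean_kappa_bound[OF r z] by (simp add: m_def)
  finally show ?thesis by (simp add: mean_kappa_deriv_def m_def q_def)
qed

text \<open>A bound uniform in the dilation, for dominated convergence. It follows from the triangle
  inequality and \<open>(u + b)^2 \<le> 2 * u^2 + 2 * b^2\<close>; its decay in \<open>y\<close> is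
  that of a Gaussian of variance 2.\<close>

lemma mvn_density_dilation_le:
  fixes \<beta> y :: "real ^ 'p"
  assumes s: "1 \<le> s"
  shows "mvn_density \<beta> 1 (s *\<^sub>R y) \<le> (1 / sqrt (2 * pi)) ^ CARD('p) * exp ((norm \<beta>)\<^sup>2 / 2) * exp (- (norm y)\<^sup>2 / 4)"
proof -
  define u where "u = norm (s *\<^sub>R y - \<beta>)"
  have "norm y \<le> s * norm y" using s by (simp add: mult_le_cancel_right1)
  also have "\<dots> = norm (s *\<^sub>R y)" using s by simp
  also have "\<dots> \<le> u + norm \<beta>" unfolding u_def using norm_triangle_ineq[of "s *\<^sub>R y - \<beta>" \<beta>] by simp
  finally have "(norm y)\<^sup>2 \<le> (u + norm \<beta>)\<^sup>2" by (intro power_mono) auto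
  also have "\<dots> \<le> 2 * u\<^sup>2 + 2 * (norm \<beta>)\<^sup>2"
    using zero_le_power2[of "u - norm \<beta>"] by (simp add: power2_eq_square algebra_simps)
  finally have "exp (- u\<^sup>2 / 2) \<le> exp ((norm \<beta>)\<^sup>2 / 2 + - (norm y)\<^sup>2 / 4)" by simp
  hence "exp (- u\<^sup>2 / 2) \<le> exp ((norm \<beta>)\<^sup>2 / 2) * exp (- (norm y)\<^sup>2 / 4)" by (simp only: exp_add)
  hence "(1 / sqrt (2 * pi)) ^ CARD('p) * exp (- u\<^sup>2 / 2)
      \<le> (1 / sqrt (2 * pi)) ^ CARD('p) * (exp ((norm \<beta>)\<^sup>2 / 2) * exp (- (norm y)\<^sup>2 / 4))"
    by (intro mult_left_mono) auto
  thus ?thesis by (simp add: mvn_density_eq u_def mult.assoc)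
qed

lemma mvn_density_dilation_has_derivative:
  fixes \<beta> y :: "real ^ 'p"
  shows "((\<lambda>s. mvn_density \<beta> 1 (s *\<^sub>R y)) has_real_derivative
    - mvn_density \<beta> 1 (s *\<^sub>R y) * ((s *\<^sub>R y - \<beta>) \<bullet> y)) (at s)"
proof -
  have eq: "mvn_density \<beta> 1 (l *\<^sub>R y) = (1 / sqrt (2 * pi)) ^ CARD('p) *
      exp (- (l\<^sup>2 * (y \<bullet> y) - 2 * l * (\<beta> \<bullet> y) + \<beta> \<bullet> \<beta>) / 2)" for l
  proof -
    have "(norm (l *\<^sub>R y - \<beta>))\<^sup>2 = l\<^sup>2 * (y \<bullet> y) - 2 * l * (\<beta> \<bullet> y) + \<beta> \<bullet> \<beta>"
      unfolding power2_norm_eq_inner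
      by (simp add: inner_diff_left inner_diff_right inner_commute power2_eq_square)
    thus ?thesis by (simp add: mvn_density_eq)
  qed
  show ?thesis
    unfolding eq by (auto intro!: derivative_eq_intros simp: inner_diff_left field_simps)
qed

text \<open>\<open>\<Psi>\<close> is the divergence of the field \<open>y\<close> scaled by the
  density and the shrinkage weight, that is, the dilation derivative at 1 of their product
  \<open>f\<close>.\<close>

lemma Stein_identity_mean_kappa:
  fixes \<beta> :: "real ^ 'p"
  defines "r \<equiv> real CARD('p) / 2"
  defines "\<Psi> \<equiv> \<lambda>y. mvn_density \<beta> 1 y * (real CARD('p) * mean_kappa r ((norm y)\<^sup>2 / 2)
     + (norm y)\<^sup>2 * mean_kappa_deriv r ((norm y)\<^sup>2 / 2) - mean_kappa r ((norm y)\<^sup>2 / 2) * ((y - \<beta>) \<bullet> y))"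
  shows "integrable lborel \<Psi>" and "integral\<^sup>L lborel \<Psi> = 0"
proof -
  let ?p = "CARD('p)"
  have r: "0 \<le> r" by (simp add: r_def)
  define m where "m s y = mean_kappa r (s\<^sup>2 * ((norm y)\<^sup>2 / 2))" for s and y :: "real ^ 'p"
  define d where "d s y = mean_kappa_deriv r (s\<^sup>2 * ((norm y)\<^sup>2 / 2))" for s and y :: "real ^ 'p"
  define g where "g = mvn_density \<beta> 1"
  define f where "f y = m 1 y * g y" for y
  define k where "k s y = real ?p * s ^ (?p - 1) * (m s y * g (s *\<^sub>R y))
     + s ^ ?p * (d s y * (s * (norm y)\<^sup>2) * g (s *\<^sub>R y) + m s y * (- g (s *\<^sub>R y) * ((s *\<^sub>R y - \<beta>) \<bullet> y)))"
    for s y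
  \<comment> \<open>Chosen so that \<open>K * mvn_density 0 2 y\<close> is \<open>2 ^ ?p\<close>
    times the uniform bound on the dilated density. The 5 in \<open>w\<close> is 2 + 3, from the
    bounds \<open>t2\<close> and \<open>t3\<close>.\<close>
  define K where "K = 2 ^ ?p * ((1 / sqrt (2 * pi)) ^ ?p * exp ((norm \<beta>)\<^sup>2 / 2) / (1 / sqrt (2 * pi * 2)) ^ ?p)"
  define w where "w y = K * ((real ?p + (norm \<beta>)\<^sup>2) * mvn_density 0 2 y + 5 * (mvn_density 0 2 y * (norm (y - 0))\<^sup>2))"
    for y :: "real ^ 'p"
  have [measurable]: "g \<in> borel_measurable borel" unfolding g_def by measurable
  have g0: "0 \<le> g y" for y by (simp add: g_def mvn_density_nonneg)
  have m: "0 \<le> m s y" "m s y \<le> 1" for s y using r by (auto simp: m_def intro!: mean_kappa_range)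
  have d: "\<bar>d s y\<bar> \<le> 1" for s y unfolding d_def using r by (intro abs_mean_kappa_deriv_le) auto
  have w_int: "integrable lborel w" unfolding w_def
    by (intro integrable_mult_right Bochner_Integration.integrable_add integrable_mvn_density integrable_mvn_second_moment) auto
  have f_int: "integrable lborel f"
  proof (rule Bochner_Integration.integrable_bound)
    show "integrable lborel g" unfolding g_def by (rule integrable_mvn_density) simp
    show "f \<in> borel_measurable lborel" unfolding f_def m_def by measurable
    show "AE y in lborel. norm (f y) \<le> norm (g y)"
      using m g0 by (intro AE_I2) (simp add: f_def abs_mult mult_left_le_one_le)
  qed
  have der: "((\<lambda>s. s ^ DIM(real ^ 'p) * f (s *\<^sub>R y)) has_real_derivative k s y) (at s)"
    if y: "y \<noteq> 0" and s: "s \<in> {1..2}" for y s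
  proof -
    have "0 < s\<^sup>2 * ((norm y)\<^sup>2 / 2)" using y s by simp
    hence M: "((\<lambda>s. m s y) has_real_derivative d s y * (s * (norm y)\<^sup>2)) (at s)"
      unfolding m_def d_def
      by (intro DERIV_chain2[OF mean_kappa_has_derivative[OF r]]) (auto intro!: derivative_eq_intros)
    have "m s y = m 1 (s *\<^sub>R y)" for s by (simp add: m_def power_mult_distrib)
    hence "(\<lambda>s. s ^ DIM(real ^ 'p) * f (s *\<^sub>R y)) = (\<lambda>s. s ^ ?p * (m s y * g (s *\<^sub>R y)))"
      by (simp add: f_def)
    thus ?thesis
      unfolding k_def g_def
      by (auto intro!: derivative_eq_intros M mvn_density_dilation_has_derivative simp: algebra_simps)
  qed
  have bound: "\<bar>k s y\<bar> \<le> w y" if s: "s \<in> {1..2}" for y s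
  proof -
    let ?G = "g (s *\<^sub>R y)"
    have pw: "0 \<le> s ^ (?p - 1)" "s ^ (?p - 1) \<le> 2 ^ ?p" "0 \<le> s ^ ?p" "s ^ ?p \<le> 2 ^ ?p"
    proof -
      have "s ^ (?p - 1) \<le> s ^ ?p" using s by (intro power_increasing) auto
      moreover show "s ^ ?p \<le> 2 ^ ?p" using s by (intro power_mono) auto
      ultimately show "s ^ (?p - 1) \<le> 2 ^ ?p" by linarith
    qed (use s in auto)
    have ip: "\<bar>(s *\<^sub>R y - \<beta>) \<bullet> y\<bar> \<le> 3 * (norm y)\<^sup>2 + (norm \<beta>)\<^sup>2"
    proof -
      have "\<bar>(s *\<^sub>R y - \<beta>) \<bullet> y\<bar> \<le> norm (s *\<^sub>R y - \<beta>) * norm y" by (rule Cauchy_Schwarz_ineq2)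
      also have "\<dots> \<le> (2 * norm y + norm \<beta>) * norm y"
      proof (intro mult_right_mono)
        have "norm (s *\<^sub>R y - \<beta>) \<le> s * norm y + norm \<beta>"
          using norm_triangle_ineq4[of "s *\<^sub>R y" \<beta>] s by simp
        moreover have "s * norm y \<le> 2 * norm y" using s by (intro mult_right_mono) auto
        ultimately show "norm (s *\<^sub>R y - \<beta>) \<le> 2 * norm y + norm \<beta>" by linarith
      qed simp
      also have "\<dots> \<le> 3 * (norm y)\<^sup>2 + (norm \<beta>)\<^sup>2"
      proof -
        have "norm y * norm \<beta> \<le> (norm y)\<^sup>2 + (norm \<beta>)\<^sup>2"
          using sum_squares_bound[of "norm y" "norm \<beta>"] mult_nonneg_nonneg[OF norm_ge_zero[of y] norm_ge_zero[of \<beta>]]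
          by linarith
        thus ?thesis by (simp add: power2_eq_square algebra_simps)
      qed
      finally show ?thesis .
    qed
    have t1: "\<bar>real ?p * s ^ (?p - 1) * (m s y * ?G)\<bar> \<le> 2 ^ ?p * (real ?p * ?G)"
    proof -
      have "s ^ (?p - 1) * (m s y * ?G) \<le> 2 ^ ?p * (1 * ?G)"
        using pw m g0 by (intro mult_mono) auto
      from mult_left_mono[OF this, of "real ?p"] show ?thesis
        using pw m g0 by (simp add: abs_mult mult_ac)
    qed
    have t2: "\<bar>d s y * (s * (norm y)\<^sup>2) * ?G\<bar> \<le> 2 * (norm y)\<^sup>2 * ?G"
    proof -
      have "\<bar>d s y\<bar> * (s * (norm y)\<^sup>2) \<le> 1 * (2 * (norm y)\<^sup>2)"
        using d s by (intro mult_mono) auto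
      from mult_right_mono[OF this g0[of "s *\<^sub>R y"]] show ?thesis
        using s g0 by (simp add: abs_mult)
    qed
    have t3: "\<bar>m s y * (- ?G * ((s *\<^sub>R y - \<beta>) \<bullet> y))\<bar> \<le> (3 * (norm y)\<^sup>2 + (norm \<beta>)\<^sup>2) * ?G"
    proof -
      have "m s y * \<bar>(s *\<^sub>R y - \<beta>) \<bullet> y\<bar> \<le> 1 * (3 * (norm y)\<^sup>2 + (norm \<beta>)\<^sup>2)"
        using m ip by (intro mult_mono) auto
      from mult_right_mono[OF this g0[of "s *\<^sub>R y"]] show ?thesis
        using m g0 by (simp add: abs_mult mult_ac)
    qed
    have "\<bar>s ^ ?p * (d s y * (s * (norm y)\<^sup>2) * ?G + m s y * (- ?G * ((s *\<^sub>R y - \<beta>) \<bullet> y)))\<bar>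
        \<le> 2 ^ ?p * (2 * (norm y)\<^sup>2 * ?G + (3 * (norm y)\<^sup>2 + (norm \<beta>)\<^sup>2) * ?G)"
      unfolding abs_mult using pw t2 t3
      by (intro mult_mono order.trans[OF abs_triangle_ineq] add_mono) auto
    hence "\<bar>k s y\<bar> \<le> 2 ^ ?p * (real ?p * ?G) + 2 ^ ?p * (2 * (norm y)\<^sup>2 * ?G + (3 * (norm y)\<^sup>2 + (norm \<beta>)\<^sup>2) * ?G)"
      unfolding k_def using t1 by (intro order.trans[OF abs_triangle_ineq] add_mono)
    also have "\<dots> = 2 ^ ?p * (real ?p + (norm \<beta>)\<^sup>2 + 5 * (norm y)\<^sup>2) * ?G" by (simp add: algebra_simps)
    also have "\<dots> \<le> 2 ^ ?p * (real ?p + (norm \<beta>)\<^sup>2 + 5 * (norm y)\<^sup>2) *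
       ((1 / sqrt (2 * pi)) ^ ?p * exp ((norm \<beta>)\<^sup>2 / 2) * exp (- (norm y)\<^sup>2 / 4))"
      using s unfolding g_def by (intro mult_left_mono mvn_density_dilation_le) auto
    also have "\<dots> = w y"
    proof -
      have "mvn_density 0 2 y = (1 / sqrt (2 * pi * 2)) ^ ?p * exp (- (norm y)\<^sup>2 / 4)"
        by (simp add: mvn_density_eq)
      moreover have "(1 / sqrt (2 * pi * 2)) ^ ?p \<noteq> 0" by simp
      ultimately have "K * mvn_density 0 2 y
          = 2 ^ ?p * ((1 / sqrt (2 * pi)) ^ ?p * exp ((norm \<beta>)\<^sup>2 / 2) * exp (- (norm y)\<^sup>2 / 4))"
        unfolding K_def by (simp only:) (simp add: field_simps)
      moreover have "w y = (real ?p + (norm \<beta>)\<^sup>2 + 5 * (norm y)\<^sup>2) * (K * mvn_density 0 2 y)"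
        by (simp add: w_def algebra_simps)
      ultimately show ?thesis by (simp only: mult_ac)
    qed
    finally show ?thesis .
  qed
  have k1: "k 1 = \<Psi>"
    by (simp add: fun_eq_iff k_def \<Psi>_def g_def m_def d_def algebra_simps)
  have "\<Psi> \<in> borel_measurable borel" unfolding \<Psi>_def by measurable
  moreover have "AE y in lborel. \<forall>s\<in>{1..2}.
      ((\<lambda>s. s ^ DIM(real ^ 'p) * f (s *\<^sub>R y)) has_real_derivative k s y) (at s) \<and> \<bar>k s y\<bar> \<le> w y"
    \<comment> \<open>The origin is excluded because \<open>mean_kappa\<close> is differentiated
      only at positive arguments.\<close>
    using AE_lborel_singleton[of 0] by eventually_elim (use der bound in blast)
  ultimately show "integrable lborel \<Psi>" "integral\<^sup>L lborel \<Psi> = 0"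
    using integral_dilation_derivative[OF f_int w_int, of k] k1 by auto
qed

section \<open>Risk bound and minimaxity\<close>

lemma beta_hat_measurable: "(beta_hat :: real ^ 'p \<Rightarrow> real ^ 'p) \<in> borel_measurable borel"
  unfolding beta_hat_eq[abs_def] by measurable

text \<open>Adding \<open>2 * \<Psi>\<close>, which integrates to 0, to the loss density of the
  identity gives \<open>U\<close> with integral \<open>CARD('p)\<close>. Expanding the loss of the
  estimator, \<open>U\<close> exceeds its density by \<open>2 * g y\<close> times the slack of
  \<open>mean_kappa_risk_ineq\<close>; the dimension bound gives \<open>r \<ge> 7/2\<close>.\<close>

lemma risk_beta_hat_le:
  fixes \<beta> :: "real ^ 'p"
  assumes p: "7 \<le> CARD('p)"
  shows "risk \<beta> beta_hat \<le> ennreal (real CARD('p))"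
proof -
  define r where "r = real CARD('p) / 2"
  define g where "g = mvn_density \<beta> 1"
  define \<Psi> where "\<Psi> y = g y * (real CARD('p) * mean_kappa r ((norm y)\<^sup>2 / 2)
     + (norm y)\<^sup>2 * mean_kappa_deriv r ((norm y)\<^sup>2 / 2) - mean_kappa r ((norm y)\<^sup>2 / 2) * ((y - \<beta>) \<bullet> y))" for y
  define U where "U y = g y * (norm (y - \<beta>))\<^sup>2 + 2 * \<Psi> y" for y
  have \<Psi>: "integrable lborel \<Psi>" "integral\<^sup>L lborel \<Psi> = 0"
    using Stein_identity_mean_kappa[of \<beta>] unfolding \<Psi>_def g_def r_def by auto
  have U: "integrable lborel U" "integral\<^sup>L lborel U = real CARD('p)"
    unfolding U_def g_def using \<Psi> integrable_mvn_second_moment[of 1 \<beta>] by simp_all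
  have le: "g y * (norm (beta_hat y - \<beta>))\<^sup>2 \<le> U y" for y
  proof -
    define z where "z = (norm y)\<^sup>2 / 2"
    define m where "m = mean_kappa r z"
    have y2: "(norm y)\<^sup>2 = 2 * z" "y \<bullet> y = 2 * z" by (simp_all add: z_def power2_norm_eq_inner)
    have "z * m\<^sup>2 \<le> 2 * r * m + 2 * z * mean_kappa_deriv r z"
      unfolding m_def using p by (intro mean_kappa_risk_ineq) (auto simp: r_def z_def)
    hence "0 \<le> 2 * g y * (2 * r * m + 2 * z * mean_kappa_deriv r z - z * m\<^sup>2)"
      by (simp add: g_def mvn_density_nonneg)
    also have "\<dots> = U y - g y * ((norm (y - \<beta>))\<^sup>2 - 2 * m * ((y - \<beta>) \<bullet> y) + m\<^sup>2 * (2 * z))"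
      unfolding U_def \<Psi>_def y2 by (simp add: m_def r_def algebra_simps)
    also have "(norm (y - \<beta>))\<^sup>2 - 2 * m * ((y - \<beta>) \<bullet> y) + m\<^sup>2 * (2 * z) = (norm (beta_hat y - \<beta>))\<^sup>2"
    proof -
      have "beta_hat y - \<beta> = (y - \<beta>) - m *\<^sub>R y"
        by (simp add: beta_hat_eq m_def r_def z_def algebra_simps)
      hence "(norm (beta_hat y - \<beta>))\<^sup>2 = ((y - \<beta>) - m *\<^sub>R y) \<bullet> ((y - \<beta>) - m *\<^sub>R y)"
        by (simp only: power2_norm_eq_inner)
      also have "\<dots> = (y - \<beta>) \<bullet> (y - \<beta>) - 2 * m * ((y - \<beta>) \<bullet> y) + m\<^sup>2 * (y \<bullet> y)"
        unfolding inner_diff_left[of "y - \<beta>"] inner_diff_right[of _ "y - \<beta>"]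
        by (simp add: inner_commute power2_eq_square)
      finally show ?thesis by (simp only: power2_norm_eq_inner y2)
    qed
    finally show ?thesis by simp
  qed
  have "risk \<beta> beta_hat = (\<integral>\<^sup>+y. ennreal (g y * (norm (beta_hat y - \<beta>))\<^sup>2) \<partial>lborel)"
    unfolding g_def by (rule risk_eq[OF beta_hat_measurable])
  also have "\<dots> \<le> (\<integral>\<^sup>+y. ennreal (U y) \<partial>lborel)"
    by (intro nn_integral_mono ennreal_leI le)
  also have "\<dots> = ennreal (real CARD('p))"
  proof -
    have "0 \<le> U y" for y using le[of y] by (rule order.trans[rotated]) (simp add: g_def mvn_density_nonneg)
    thus ?thesis using U by (simp add: nn_integral_eq_integral)
  qed
  finally show ?thesis .
qed

theorem theorem1p1:
  assumes "CARD('p::finite) \<ge> 7"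
  shows "(\<forall>y. (beta_hat :: real ^ 'p \<Rightarrow> real ^ 'p) y
                = posterior_mean (mixture_prior half_cauchy_kappa) y)
       \<and> minimax (beta_hat :: real ^ 'p \<Rightarrow> real ^ 'p)"
proof
  show "\<forall>y. (beta_hat :: real ^ 'p \<Rightarrow> real ^ 'p) y = posterior_mean (mixture_prior half_cauchy_kappa) y"
    by (simp add: beta_hat_eq posterior_mean_half_cauchy)
  have est: "(beta_hat :: real ^ 'p \<Rightarrow> real ^ 'p) \<in> estimators"
    by (simp add: estimators_def beta_hat_measurable)
  have "(SUP \<beta>. risk \<beta> (beta_hat :: real ^ 'p \<Rightarrow> real ^ 'p)) \<le> ennreal (real CARD('p))"
    by (intro SUP_least risk_beta_hat_le assms)
  also have "\<dots> \<le> (INF \<delta>'\<in>(estimators :: (real ^ 'p \<Rightarrow> real ^ 'p) set). SUP \<beta>. risk \<beta> \<delta>')"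
    by (intro INF_greatest sup_risk_ge) (simp add: estimators_def)
  finally show "minimax (beta_hat :: real ^ 'p \<Rightarrow> real ^ 'p)"
    unfolding minimax_def using est by (auto intro!: antisym INF_lower)
qed

end
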